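(* Let $\mathcal A$ be a simplicial arrangement with base region $B$ and set $\mathcal B$ of facet-defining hyperplanes of $B$. The Möbius number $\mu_\preceq(B,-B)$ of the shard intersection order $(\mathcal R,\preceq)$ is $(-1)^{\operatorname{rank}(\mathcal A)}$ times the number of regions not contained in any proper standard parabolic subset of $\mathcal R$. Equivalently, \[\mu_\preceq(B,-B)=\sum_{\mathcal K\subseteq\mathcal B}(-1)^{|\mathcal K|}\,|\mathcal R_{\mathcal K}|.\]
   Context: Let $\mathcal A$ be a finite set of linear hyperplanes in a real vector space $V$; $\operatorname{rank}(\mathcal A)$ is the codimension of $\bigcap\mathcal A$. Regions are closures of connected components of $V\setminus\bigcup\mathcal A$; $\mathcal R$ is the set of regions; $\mathcal A$ is simplicial if for every region the normal vectors of its facet-defining hyperplanes are linearly independent. Fix a region $B$; $S(R)$ is the set of hyperplanes separating $R$ from $B$. For $\mathcal K\subseteq\mathcal B$, $\mathcal A_{\mathcal K}=\{H\in\mathcal A:H\supseteq\bigcap\mathcal K\}$ ($\bigcap\emptyset=V$), and $\mathcal R_{\mathcal K}=\{R\in\mathcal R:S(R)\subseteq\mathcal A_{\mathcal K}\}$ is a standard parabolic subset; it is proper if $\mathcal K\ne\mathcal B$. A full subarrangement is the set of all hyperplanes of $\mathcal A$ containing a given subset of $V$; its basic hyperplanes are the facet-defining hyperplanes of its region containing $B$. For distinct $H,H'\in\mathcal A$, $H$ cuts $H'$ if, in the full subarrangement of hyperplanes containing $H\cap H'$, $H$ is basic and $H'$ is not. The shards in $H$ are the closures of components of $H$ minus all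 hyperplanes cutting $H$; $H(\Sigma)$ is the hyperplane containing $\Sigma$. $\Psi$ is the set of all intersections of sets of shards (including $V$). $\Sigma$ is a lower shard of region $R$ if $\dim(R\cap\Sigma)=\dim\Sigma$ and $H(\Sigma)\in S(R)$; $\psi(R)$ is the intersection of all lower shards of $R$. $\psi:\mathcal R\to\Psi$ is a bijection, and the shard intersection order is $Q\preceq R$ iff $\psi(Q)\supseteq\psi(R)$; it is a lattice with minimum $B$ and maximum $-B$. *)

theory Defs
  imports "HOL-Analysis.Analysis"
begin

section \<open>Arrangements and regions\<close>

definition linear_hyperplane :: "'a::euclidean_space set \<Rightarrow> bool" where
  "linear_hyperplane H \<longleftrightarrow> subspace H \<and> dim H + 1 = DIM('a)"

definition arrangement :: "'a::euclidean_space set set \<Rightarrow> bool" where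
  "arrangement \<A> \<longleftrightarrow> finite \<A> \<and> (\<forall>H\<in>\<A>. linear_hyperplane H)"

definition arr_rank :: "'a::euclidean_space set set \<Rightarrow> nat" where
  "arr_rank \<A> = DIM('a) - dim (\<Inter>\<A>)"

definition regions :: "'a::euclidean_space set set \<Rightarrow> 'a set set" where
  "regions \<A> = closure ` components (UNIV - \<Union>\<A>)"

definition facet_hyperplanes :: "'a::euclidean_space set set \<Rightarrow> 'a set \<Rightarrow> 'a set set" where
  "facet_hyperplanes \<A> R = {H \<in> \<A>. (R \<inter> H) facet_of R}"

definition normal_vector :: "'a::euclidean_space \<Rightarrow> 'a set \<Rightarrow> bool" where
  "normal_vector n H \<longleftrightarrow> n \<noteq> 0 \<and> H = {x. n \<bullet> x = 0}"

text \<open>Independence does not depend on the choice of the normal vectors, which are unique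
  up to nonzero scaling; distinct hyperplanes have distinct normals, so no multiplicity is
  lost by passing to the image.\<close>

definition simplicial_arrangement :: "'a::euclidean_space set set \<Rightarrow> bool" where
  "simplicial_arrangement \<A> \<longleftrightarrow> arrangement \<A> \<and>
     (\<forall>R\<in>regions \<A>. \<forall>n. (\<forall>H\<in>facet_hyperplanes \<A> R. normal_vector (n H) H) \<longrightarrow>
        independent (n ` facet_hyperplanes \<A> R))"

text \<open>Regions are full-dimensional, hence never contained in a hyperplane, so closed
  half-spaces may be used to say that \<open>H\<close> has \<open>Q\<close> and \<open>R\<close> on opposite sides.\<close>

definition separates :: "'a::euclidean_space set \<Rightarrow> 'a set \<Rightarrow> 'a set \<Rightarrow> bool" where
  "separates H Q R \<longleftrightarrow>
     (\<exists>n. normal_vector n H \<and> (\<forall>x\<in>Q. n \<bullet> x \<le> 0) \<and> (\<forall>x\<in>R. n \<bullet> x \<ge> 0))"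

definition sep_set :: "'a::euclidean_space set set \<Rightarrow> 'a set \<Rightarrow> 'a set \<Rightarrow> 'a set set" where
  "sep_set \<A> B R = {H \<in> \<A>. separates H R B}"

section \<open>Full subarrangements and standard parabolic subsets\<close>

definition full_subarrangement ::
    "'a::euclidean_space set set \<Rightarrow> 'a set \<Rightarrow> 'a set set" where
  "full_subarrangement \<A> X = {H \<in> \<A>. X \<subseteq> H}"

text \<open>Here \<open>B\<close> is a region of an arrangement containing \<open>\<A>\<close>, so exactly one region of
  \<open>\<A>\<close> contains it.  If \<open>B\<close> is itself a region of \<open>\<A>\<close>, these are the facet-defining
  hyperplanes of \<open>B\<close>.\<close>

definition basic_hyperplanes ::
    "'a::euclidean_space set set \<Rightarrow> 'a set \<Rightarrow> 'a set set" where
  "basic_hyperplanes \<A> B = facet_hyperplanes \<A> (THE R. R \<in> regions \<A> \<and> B \<subseteq> R)"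

definition parabolic_subset ::
    "'a::euclidean_space set set \<Rightarrow> 'a set \<Rightarrow> 'a set set \<Rightarrow> 'a set set" where
  "parabolic_subset \<A> B \<K> =
     {R \<in> regions \<A>. sep_set \<A> B R \<subseteq> full_subarrangement \<A> (\<Inter>\<K>)}"

section \<open>Shards and the shard intersection order\<close>

definition cuts ::
    "'a::euclidean_space set set \<Rightarrow> 'a set \<Rightarrow> 'a set \<Rightarrow> 'a set \<Rightarrow> bool" where
  "cuts \<A> B H H' \<longleftrightarrow> H \<in> \<A> \<and> H' \<in> \<A> \<and> H \<noteq> H' \<and>
     H \<in> basic_hyperplanes (full_subarrangement \<A> (H \<inter> H')) B \<and>
     H' \<notin> basic_hyperplanes (full_subarrangement \<A> (H \<inter> H')) B"

definition shards_in ::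
    "'a::euclidean_space set set \<Rightarrow> 'a set \<Rightarrow> 'a set \<Rightarrow> 'a set set" where
  "shards_in \<A> B H = closure ` components (H - \<Union>{H'. cuts \<A> B H' H})"

definition shards :: "'a::euclidean_space set set \<Rightarrow> 'a set \<Rightarrow> 'a set set" where
  "shards \<A> B = (\<Union>H\<in>\<A>. shards_in \<A> B H)"

text \<open>A shard is full-dimensional in its hyperplane, hence lies in only one.\<close>

definition shard_hyperplane :: "'a::euclidean_space set set \<Rightarrow> 'a set \<Rightarrow> 'a set" where
  "shard_hyperplane \<A> \<Sigma> = (THE H. H \<in> \<A> \<and> \<Sigma> \<subseteq> H)"

definition lower_shards ::
    "'a::euclidean_space set set \<Rightarrow> 'a set \<Rightarrow> 'a set \<Rightarrow> 'a set set" where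
  "lower_shards \<A> B R =
     {\<Sigma> \<in> shards \<A> B. aff_dim (R \<inter> \<Sigma>) = aff_dim \<Sigma> \<and> shard_hyperplane \<A> \<Sigma> \<in> sep_set \<A> B R}"

text \<open>The map \<open>\<psi>\<close> from regions to intersections of shards; the empty intersection is the
  whole space, so \<open>B\<close> is mapped to \<open>UNIV\<close>.\<close>

definition shard_meet ::
    "'a::euclidean_space set set \<Rightarrow> 'a set \<Rightarrow> 'a set \<Rightarrow> 'a set" where
  "shard_meet \<A> B R = \<Inter>(lower_shards \<A> B R)"

text \<open>The order on regions induced by \<^const>\<open>shard_meet\<close> from reverse inclusion, as a set of
  pairs \<open>(Q, R)\<close> with \<open>Q\<close> below \<open>R\<close>.\<close>

definition shard_order ::
    "'a::euclidean_space set set \<Rightarrow> 'a set \<Rightarrow> ('a set \<times> 'a set) set" where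
  "shard_order \<A> B = {(Q, R). Q \<in> regions \<A> \<and> R \<in> regions \<A> \<and>
     shard_meet \<A> B R \<subseteq> shard_meet \<A> B Q}"

section \<open>Moebius function of a finite poset\<close>

text \<open>The usual recursion \<open>\<mu>(x,x) = 1\<close> and \<open>\<mu>(x,y) = - (\<Sum>z. \<mu>(x,z))\<close>, summing over
  \<open>x \<le> z < y\<close>; for \<open>x\<close> not below \<open>y\<close> the sum is empty.  The guard only secures termination;
  outside finite posets the value is junk.\<close>

function moebius :: "'b set \<Rightarrow> ('b \<times> 'b) set \<Rightarrow> 'b \<Rightarrow> 'b \<Rightarrow> int" where
  "moebius P r x y =
     (if finite P \<and> partial_order_on P r \<and> x \<in> P \<and> y \<in> P then
        if x = y then 1
        else - (\<Sum>z\<in>{z \<in> P. (x, z) \<in> r \<and> (z, y) \<in> r \<and> z \<noteq> y}. moebius P r x z)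
      else 0)"
  by pat_completeness auto
termination
proof (relation "Wellfounded.measure (\<lambda>(P, r, x, y). card {z \<in> P. (z, y) \<in> r})", simp, clarify)
  fix P :: "'b set" and r and x y z :: 'b
  assume fin: "finite P" and po: "partial_order_on P r"
    and y: "y \<in> P" and z: "z \<in> P" "(z, y) \<in> r" "z \<noteq> y"
  have "{w \<in> P. (w, z) \<in> r} \<subseteq> {w \<in> P. (w, y) \<in> r}"
    using po z by (auto simp: partial_order_on_def preorder_on_def dest: transD)
  moreover have "y \<in> {w \<in> P. (w, y) \<in> r}"
    using po y by (auto simp: partial_order_on_def preorder_on_def refl_on_def)
  moreover have "y \<notin> {w \<in> P. (w, z) \<in> r}"
    using po z by (auto simp: partial_order_on_def antisym_def)
  ultimately have "{w \<in> P. (w, z) \<in> r} \<subset> {w \<in> P. (w, y) \<in> r}" by blast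
  then show "((P, r, x, z), (P, r, x, y)) \<in> Wellfounded.measure (\<lambda>(P, r, x, y). card {z \<in> P. (z, y) \<in> r})"
    using fin by (simp add: psubset_card_mono)
qed

declare moebius.simps [simp del]

end

theory Submission
  imports Defs
begin

text \<open>
  Choose normals positive at a point \<open>b\<close> inside \<open>B\<close>; a region \<open>R\<close> becomes its separating set and
  \<open>\<psi>(R)\<close> a cone cut out by linear inequalities. The candidate for \<open>\<mu>(B, R)\<close> is
  \<open>g(R) = \<Sum>K. (-1)^|K| N(K)\<close>, where \<open>K\<close> runs over the sets of lower walls of \<open>R\<close> and \<open>N(K)\<close> is the
  number of regions of the localization at \<open>\<Inter>K\<close>. Two facts show that \<open>g\<close> satisfies the Moebius
  recursion.

  First, the interval below \<open>R\<close> is in bijection with the regions of the localization at the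
  intersection of the lower walls of \<open>R\<close>, and the bijection preserves lower walls. Call two points
  equivalent if they lie on the same hyperplanes and are separated by no hyperplane that cuts a basic
  hyperplane of their localization. Each class contains exactly one lower face of a region: any point
  can descend towards \<open>B\<close> until it reaches such a face, and descents are confluent. So regions
  correspond to classes, both in the arrangement and in the localization.

  Second, \<open>\<Sum>R. g(R) = 0\<close> for a nonempty arrangement: grouped by faces \<open>F\<close>, it is the sum of
  \<open>(-1)^codim F\<close> times the number of regions containing \<open>F\<close>, and grouping this by regions instead
  gives alternating sums over the faces of simplicial cones, which vanish.
\<close>

text \<open>The candidate \<open>g\<close> is the claimed alternating sum with the facets of
  \<open>B\<close> replaced by the lower walls of \<open>R\<close>. At \<open>-B\<close> the lower
  walls are the basic hyperplanes, and for \<open>K\<close> among these the regions of the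
  localization at \<open>\<Inter>K\<close> are the members of \<open>R_K\<close>; so
  \<open>g(-B)\<close> is the second formula. The other formula follows because every region has a
  least \<open>K\<close> with \<open>R\<close> in \<open>R_K\<close>. Simpliciality enters as a form
  of Farkas' lemma: wall normals have dual vectors, so all inward normals are nonnegative
  combinations of them, and every set of walls cuts out a face. Two obstacles shape the proof.
  Inclusion of \<open>\<psi>(R)\<close> in \<open>\<psi>(Q)\<close> is a global condition; it is
  reduced to membership in \<open>\<psi>(Q)\<close> of one generic point of the lower face of
  \<open>R\<close>, which permits localization. And confluence of descents only compares points with
  nested negative sets; uniqueness in a whole class needs the class to be connected. Both reductions
  rest on the fact that a hyperplane cut by no other is basic.\<close>

lemma sum_sign_interval:
  fixes W :: "'b set"
  assumes "finite W" "M \<subseteq> W"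
  shows "(\<Sum>K | K \<subseteq> W \<and> M \<subseteq> K. (-1) ^ card K) = (if M = W then (-1) ^ card W else (0::int))"
proof (cases "M = W")
  case True
  then have "{K. K \<subseteq> W \<and> M \<subseteq> K} = {W}" by auto
  then show ?thesis using True by simp
next
  case False
  then have "M \<subset> W" using assms by blast
  moreover have "finite {K. K \<subseteq> W \<and> M \<subseteq> K}"
    by (rule finite_subset[of _ "Pow W"]) (use assms in auto)
  ultimately have "(\<Sum>K | K \<subseteq> W \<and> M \<subseteq> K. (-1) ^ card K) = (0::int)"
    by (intro sum_alternating_cancels) (use card_subsupersets_even_odd[of W M] assms in auto)
  then show ?thesis using False by simp
qed

text \<open>The recursion has only one solution, so it is enough that the sums of \<open>g\<close>
  over principal down-sets agree with the delta function at \<open>x\<close>. As \<open>x\<close> is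
  the minimum, the lower bound in the recursion is vacuous.\<close>

lemma moebius_eqI:
  assumes P: "finite P" "partial_order_on P r" "x \<in> P" "\<And>y. y \<in> P \<Longrightarrow> (x, y) \<in> r"
    and g: "\<And>y. y \<in> P \<Longrightarrow> (\<Sum>z | z \<in> P \<and> (z, y) \<in> r. g z) = (if y = x then 1 else 0)"
    and y: "y \<in> P"
  shows "moebius P r x y = g y"
  using y
proof (induction "card {z \<in> P. (z, y) \<in> r}" arbitrary: y rule: less_induct)
  case less
  have refl: "(z, z) \<in> r" if "z \<in> P" for z
    using P(2) that by (auto simp: partial_order_on_def preorder_on_def refl_on_def)
  have anti: "a = c" if "(a, c) \<in> r" "(c, a) \<in> r" for a c
    using P(2) that by (auto simp: partial_order_on_def antisym_def)
  have tr: "(a, d) \<in> r" if "(a, c) \<in> r" "(c, d) \<in> r" for a c d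
    using P(2) that by (auto simp: partial_order_on_def preorder_on_def dest: transD)
  show ?case
  proof (cases "y = x")
    case True
    have "{z. z \<in> P \<and> (z, y) \<in> r} = {x}" using True P(3,4) anti refl by blast
    then have "g x = 1" using g[OF less.prems] True by simp
    then show ?thesis using True P by (simp add: moebius.simps)
  next
    case False
    let ?S = "{z \<in> P. (x, z) \<in> r \<and> (z, y) \<in> r \<and> z \<noteq> y}"
    have S: "?S = {z \<in> P. (z, y) \<in> r} - {y}" using P(4) by auto
    have "moebius P r x z = g z" if z: "z \<in> ?S" for z
    proof (rule less.hyps)
      have "{w \<in> P. (w, z) \<in> r} \<subseteq> {w \<in> P. (w, y) \<in> r}" using z tr by blast
      moreover have "y \<in> {w \<in> P. (w, y) \<in> r}" "y \<notin> {w \<in> P. (w, z) \<in> r}"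
        using z less.prems refl anti by auto
      ultimately show "card {w \<in> P. (w, z) \<in> r} < card {w \<in> P. (w, y) \<in> r}"
        by (intro psubset_card_mono) (use P(1) in auto)
    qed (use z in auto)
    then have "moebius P r x y = - (\<Sum>z\<in>?S. g z)"
      using False P less.prems by (subst moebius.simps) simp
    also have "\<dots> = g y"
      using g[OF less.prems] False less.prems refl P(1) unfolding S
      by (simp add: sum_diff1)
    finally show ?thesis .
  qed
qed

section \<open>Arrangements given by normal vectors\<close>

text \<open>The arrangement \<open>A\<close> is an argument of every notion, not a parameter:
  localizations are subsets of \<open>A\<close> with the same \<open>n\<close> and \<open>b\<close>,
  and the lemmas are applied to them as well.\<close>

locale normals =
  fixes n :: "'i \<Rightarrow> 'a::euclidean_space" and b :: 'a
begin

definition zero :: "'i set \<Rightarrow> 'a \<Rightarrow> 'i set" where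
  "zero A x = {i \<in> A. n i \<bullet> x = 0}"

definition neg :: "'i set \<Rightarrow> 'a \<Rightarrow> 'i set" where
  "neg A x = {i \<in> A. n i \<bullet> x < 0}"

definition signed :: "'i set \<Rightarrow> 'i \<Rightarrow> 'a" where
  "signed S i = (if i \<in> S then - n i else n i)"

text \<open>Regions of the subarrangement \<open>A\<close>, each encoded by the set of hyperplanes separating it from
  \<open>b\<close>; \<open>signed S i\<close> is the normal of \<open>i\<close> pointing into the region \<open>S\<close>.\<close>

definition sep_sets :: "'i set \<Rightarrow> 'i set set" where
  "sep_sets A = {S. S \<subseteq> A \<and> (\<exists>x. \<forall>i\<in>A. signed S i \<bullet> x > 0)}"

text \<open>The facet-defining hyperplanes, each seen through a point in the relative interior of
  its facet.\<close>

definition walls :: "'i set \<Rightarrow> 'i set \<Rightarrow> 'i set" where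
  "walls A S = {i \<in> A. \<exists>x. n i \<bullet> x = 0 \<and> (\<forall>j\<in>A - {i}. signed S j \<bullet> x > 0)}"

abbreviation lower_walls :: "'i set \<Rightarrow> 'i set \<Rightarrow> 'i set" where
  "lower_walls A S \<equiv> walls A S \<inter> S"

abbreviation basic :: "'i set \<Rightarrow> 'i set" where
  "basic A \<equiv> walls A {}"

text \<open>Closure in the linear matroid of the normals; dually, the hyperplanes containing the
  intersection of \<open>K\<close>.\<close>

definition flat :: "'i set \<Rightarrow> 'i set \<Rightarrow> 'i set" where
  "flat A K = {i \<in> A. n i \<in> span (n ` K)}"

definition cut :: "'i set \<Rightarrow> 'i \<Rightarrow> 'i \<Rightarrow> bool" where
  "cut A i j \<longleftrightarrow> i \<in> A \<and> j \<in> A \<and> i \<noteq> j \<and>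
     i \<in> basic (flat A {i, j}) \<and> j \<notin> basic (flat A {i, j})"

definition positive :: "'i set \<Rightarrow> bool" where
  "positive A \<longleftrightarrow> finite A \<and> (\<forall>i\<in>A. n i \<bullet> b > 0) \<and>
     (\<forall>i\<in>A. \<forall>j\<in>A. i \<noteq> j \<longrightarrow> n i \<notin> span {n j})"

definition simplicial :: "'i set \<Rightarrow> bool" where
  "simplicial A \<longleftrightarrow> positive A \<and> (\<forall>S\<in>sep_sets A. independent (n ` walls A S))"

lemma positive_subset: "positive A \<Longrightarrow> A' \<subseteq> A \<Longrightarrow> positive A'"
  unfolding positive_def by (meson finite_subset subsetD)

lemma positive_finite: "positive A \<Longrightarrow> finite A"
  by (simp add: positive_def)

lemma positive_inj: "positive A \<Longrightarrow> inj_on n A"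
  unfolding positive_def inj_on_def by (metis insertI1 span_base)

lemma positive_pos: "positive A \<Longrightarrow> i \<in> A \<Longrightarrow> n i \<bullet> b > 0"
  by (simp add: positive_def)

lemma simplicial_good: "simplicial A \<Longrightarrow> positive A"
  by (simp add: simplicial_def)

lemma walls_subset: "walls A S \<subseteq> A"
  by (auto simp: walls_def)

lemma finite_walls: "positive A \<Longrightarrow> finite (walls A S)"
  using positive_finite finite_subset walls_subset by blast

lemma zero_subset: "zero A x \<subseteq> A"
  by (auto simp: zero_def)

lemma flat_subset: "flat A K \<subseteq> A"
  by (auto simp: flat_def)

lemma flat_base: "K \<subseteq> A \<Longrightarrow> K \<subseteq> flat A K"
  by (auto simp: flat_def intro: span_base)

lemma flat_mono: "K \<subseteq> K' \<Longrightarrow> flat A K \<subseteq> flat A K'"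
  unfolding flat_def by (auto dest: span_mono[OF image_mono, THEN subsetD])

lemma signed_pos_iff: "signed S i \<bullet> x > 0 \<longleftrightarrow> (if i \<in> S then n i \<bullet> x < 0 else n i \<bullet> x > 0)"
  by (auto simp: signed_def)

lemma signed_zero_iff: "signed S i \<bullet> x = 0 \<longleftrightarrow> n i \<bullet> x = 0"
  by (auto simp: signed_def)

lemma sep_sets_iff: "S \<in> sep_sets A \<longleftrightarrow> (\<exists>x. zero A x = {} \<and> neg A x = S)"
proof
  assume "S \<in> sep_sets A"
  then obtain x where x: "S \<subseteq> A" "\<forall>i\<in>A. signed S i \<bullet> x > 0" by (auto simp: sep_sets_def)
  have "zero A x = {} \<and> neg A x = S"
    using x unfolding zero_def neg_def signed_pos_iff
    by (smt (verit) Collect_empty_eq Collect_cong mem_Collect_eq subset_eq Collect_mem_eq)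
  then show "\<exists>x. zero A x = {} \<and> neg A x = S" by blast
next
  assume "\<exists>x. zero A x = {} \<and> neg A x = S"
  then obtain x where x: "zero A x = {}" "neg A x = S" by blast
  then have "\<forall>i\<in>A. signed S i \<bullet> x > 0"
    unfolding signed_pos_iff zero_def neg_def by force
  then show "S \<in> sep_sets A" using x by (auto simp: sep_sets_def neg_def)
qed

lemma sep_sets_subset: "S \<in> sep_sets A \<Longrightarrow> S \<subseteq> A"
  by (simp add: sep_sets_def)

lemma finite_sep_sets: "positive A \<Longrightarrow> finite (sep_sets A)"
  by (rule finite_subset[of _ "Pow A"]) (auto simp: sep_sets_def positive_def)

lemma empty_sep_sets: "positive A \<Longrightarrow> {} \<in> sep_sets A"
  by (auto simp: sep_sets_def signed_def positive_def)

lemma perturb: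
  assumes "finite A"
  obtains e where "e > 0" "\<And>i. i \<in> A \<Longrightarrow> n i \<bullet> w > 0 \<Longrightarrow> n i \<bullet> (w + e *\<^sub>R y) > 0"
    "\<And>i. i \<in> A \<Longrightarrow> n i \<bullet> w < 0 \<Longrightarrow> n i \<bullet> (w + e *\<^sub>R y) < 0"
proof -
  have "\<exists>e>0. \<forall>i\<in>A. (n i \<bullet> w > 0 \<longrightarrow> n i \<bullet> (w + e *\<^sub>R y) > 0) \<and>
          (n i \<bullet> w < 0 \<longrightarrow> n i \<bullet> (w + e *\<^sub>R y) < 0)"
  proof -
    have lim: "((\<lambda>e. n i \<bullet> (w + e *\<^sub>R y)) \<longlongrightarrow> n i \<bullet> (w + 0 *\<^sub>R y)) (at_right (0::real))" for i
      by (intro tendsto_intros)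
    have "\<forall>\<^sub>F e in at_right (0::real). \<forall>i\<in>A. (n i \<bullet> w > 0 \<longrightarrow> n i \<bullet> (w + e *\<^sub>R y) > 0) \<and>
          (n i \<bullet> w < 0 \<longrightarrow> n i \<bullet> (w + e *\<^sub>R y) < 0)"
    proof (rule eventually_ball_finite[OF assms], rule ballI)
      fix i
      consider "n i \<bullet> w > 0" | "n i \<bullet> w < 0" | "n i \<bullet> w = 0" by linarith
      then show "\<forall>\<^sub>F e in at_right (0::real). (n i \<bullet> w > 0 \<longrightarrow> n i \<bullet> (w + e *\<^sub>R y) > 0) \<and>
          (n i \<bullet> w < 0 \<longrightarrow> n i \<bullet> (w + e *\<^sub>R y) < 0)"
      proof cases
        case 1
        then have "\<forall>\<^sub>F e in at_right (0::real). n i \<bullet> (w + e *\<^sub>R y) > 0"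
          using order_tendstoD(1)[OF lim, of 0 i] by simp
        then show ?thesis by (rule eventually_mono) (use 1 in auto)
      next
        case 2
        then have "\<forall>\<^sub>F e in at_right (0::real). n i \<bullet> (w + e *\<^sub>R y) < 0"
          using order_tendstoD(2)[OF lim, of i 0] by simp
        then show ?thesis by (rule eventually_mono) (use 2 in auto)
      qed simp
    qed
    then have "\<forall>\<^sub>F e in at_right (0::real). e > 0 \<and> (\<forall>i\<in>A. (n i \<bullet> w > 0 \<longrightarrow> n i \<bullet> (w + e *\<^sub>R y) > 0) \<and>
          (n i \<bullet> w < 0 \<longrightarrow> n i \<bullet> (w + e *\<^sub>R y) < 0))"
      using eventually_at_right_less[of "0::real"] by eventually_elim blast
    then show ?thesis by (metis (mono_tags, lifting) eventually_happens trivial_limit_at_right_real)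
  qed
  then show ?thesis using that by blast
qed

text \<open>Composition of covectors as in oriented matroids: a short step from \<open>w\<close> in
  direction \<open>y\<close> keeps the nonzero signs at \<open>w\<close> and takes the signs of
  \<open>y\<close> elsewhere.\<close>

lemma compose:
  assumes "finite A"
  obtains x where "zero A x = zero A w \<inter> zero A y" "neg A x = neg A w \<union> (zero A w \<inter> neg A y)"
proof -
  obtain e where e: "e > 0" "\<And>i. i \<in> A \<Longrightarrow> n i \<bullet> w > 0 \<Longrightarrow> n i \<bullet> (w + e *\<^sub>R y) > 0"
    "\<And>i. i \<in> A \<Longrightarrow> n i \<bullet> w < 0 \<Longrightarrow> n i \<bullet> (w + e *\<^sub>R y) < 0"
    using perturb[OF assms] by metis
  have z: "n i \<bullet> (w + e *\<^sub>R y) = e * (n i \<bullet> y)" if "n i \<bullet> w = 0" for i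
    using that by (simp add: inner_add_right)
  have zz: "e * t < 0 \<longleftrightarrow> t < 0" "e * t = 0 \<longleftrightarrow> t = 0" for t
    using e(1) by (auto simp: mult_less_0_iff)
  have 1: "n i \<bullet> (w + e *\<^sub>R y) = 0 \<longleftrightarrow> n i \<bullet> w = 0 \<and> n i \<bullet> y = 0" if "i \<in> A" for i
    using e(2,3)[OF that] z[of i] zz by (cases rule: linorder_cases[of "n i \<bullet> w" 0]) auto
  have 2: "n i \<bullet> (w + e *\<^sub>R y) < 0 \<longleftrightarrow> n i \<bullet> w < 0 \<or> n i \<bullet> w = 0 \<and> n i \<bullet> y < 0" if "i \<in> A" for i
    using e(2,3)[OF that] z[of i] zz by (cases rule: linorder_cases[of "n i \<bullet> w" 0]) auto
  show ?thesis
    by (rule that[of "w + e *\<^sub>R y"]) (use 1 2 in \<open>auto simp: zero_def neg_def\<close>)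
qed

section \<open>Walls and nonnegative combinations of their normals\<close>

lemma exists_linear_values:
  assumes "positive A" "W \<subseteq> A" "independent (n ` W)"
  obtains x where "\<And>w. w \<in> W \<Longrightarrow> n w \<bullet> x = \<phi> w"
proof -
  have inj: "inj_on n W" using positive_inj[OF assms(1)] assms(2) inj_on_subset by blast
  obtain g where g: "linear g" "\<forall>x\<in>n ` W. g x = (\<phi> (the_inv_into W n x) :: real)"
    using linear_independent_extend[OF assms(3), of "\<lambda>x. \<phi> (the_inv_into W n x)"] by auto
  \<comment> \<open>The vector representing the functional \<open>g\<close> by the inner
    product.\<close>
  define x where "x = (\<Sum>k\<in>Basis. g k *\<^sub>R k)"
  have "v \<bullet> x = g v" for v
  proof -
    have "g v = g (\<Sum>k\<in>Basis. (v \<bullet> k) *\<^sub>R k)" by (simp add: euclidean_representation)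
    also have "\<dots> = (\<Sum>k\<in>Basis. (v \<bullet> k) * g k)"
      by (simp add: linear_sum[OF g(1)] linear_cmul[OF g(1)])
    also have "\<dots> = v \<bullet> x"
      by (simp add: x_def inner_sum_right mult.commute)
    finally show ?thesis by simp
  qed
  then have "n w \<bullet> x = \<phi> w" if "w \<in> W" for w
    using g(2) that by (simp add: the_inv_into_f_f[OF inj])
  then show ?thesis using that by blast
qed

lemma orth_witness:
  assumes "v \<notin> span (V :: 'a set)"
  obtains u where "\<And>w. w \<in> span V \<Longrightarrow> w \<bullet> u = 0" "v \<bullet> u > 0"
proof -
  obtain y z where yz: "y \<in> span V" "\<And>w. w \<in> span V \<Longrightarrow> orthogonal z w" "v = y + z"
    using orthogonal_subspace_decomp_exists by blast
  have "z \<noteq> 0" using yz assms by auto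
  moreover have "y \<bullet> z = 0" using yz(1,2) by (simp add: orthogonal_def inner_commute)
  ultimately have "v \<bullet> z > 0"
    by (simp add: yz(3) inner_add_left)
  then show ?thesis using that[of z] yz by (auto simp: orthogonal_def inner_commute)
qed

text \<open>A minimal set of inequalities that cuts out the region consists of walls.\<close>

lemma region_open_cone:
  assumes A: "positive A" and S: "S \<in> sep_sets A"
  obtains W where "W \<subseteq> walls A S"
    "\<And>x. (\<And>w. w \<in> W \<Longrightarrow> signed S w \<bullet> x > 0) \<Longrightarrow> (\<And>i. i \<in> A \<Longrightarrow> signed S i \<bullet> x > 0)"
proof -
  obtain t where t: "\<And>i. i \<in> A \<Longrightarrow> signed S i \<bullet> t > 0" using S by (auto simp: sep_sets_def)
  define P where "P W \<longleftrightarrow> W \<subseteq> A \<and> (\<forall>x. (\<forall>w\<in>W. signed S w \<bullet> x > 0) \<longrightarrow> (\<forall>i\<in>A. signed S i \<bullet> x > 0))" for W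
  have "P A" by (auto simp: P_def)
  then obtain W where W: "P W" "\<And>W'. P W' \<Longrightarrow> card W \<le> card W'"
    using exists_least_iff[of "\<lambda>k. \<exists>W. P W \<and> card W = k"] by (metis not_less)
  have WA: "W \<subseteq> A" and Wc: "\<And>x i. (\<forall>w\<in>W. signed S w \<bullet> x > 0) \<Longrightarrow> i \<in> A \<Longrightarrow> signed S i \<bullet> x > 0"
    using W(1) unfolding P_def by blast+
  have finW: "finite W" using WA A positive_finite finite_subset by blast
  have cl: "signed S i \<bullet> x \<ge> 0" if "\<forall>w\<in>W. signed S w \<bullet> x \<ge> 0" "i \<in> A" for x i
  proof (rule ccontr)
    assume neg: "\<not> signed S i \<bullet> x \<ge> 0"
    \<comment> \<open>Pushing \<open>x\<close> towards the interior point \<open>t\<close> by this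
      amount makes up only half of the deficit at \<open>i\<close>, which therefore stays
      negative.\<close>
    define e where "e = - (signed S i \<bullet> x) / (2 * (signed S i \<bullet> t))"
    have e: "e > 0" using neg t[OF that(2)] by (simp add: e_def divide_neg_pos)
    have "signed S w \<bullet> (x + e *\<^sub>R t) > 0" if w: "w \<in> W" for w
    proof -
      have "e * (signed S w \<bullet> t) > 0" using t[of w] WA w e by auto
      then show ?thesis using \<open>\<forall>w\<in>W. signed S w \<bullet> x \<ge> 0\<close> w by (auto simp: inner_add_right)
    qed
    then have "signed S i \<bullet> (x + e *\<^sub>R t) > 0" using Wc that(2) by blast
    moreover have "e * (signed S i \<bullet> t) = - (signed S i \<bullet> x) / 2"
      using t[OF that(2)] by (simp add: e_def)
    ultimately show False using neg by (simp add: inner_add_right)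
  qed
  have "w \<in> walls A S" if w: "w \<in> W" for w
  proof -
    have "\<not> P (W - {w})"
      using W(2)[of "W - {w}"] w finW by (metis card_Diff1_less not_less)
    then obtain x where x: "\<forall>v\<in>W - {w}. signed S v \<bullet> x > 0" "\<not> (\<forall>i\<in>A. signed S i \<bullet> x > 0)"
      using WA by (auto simp: P_def)
    then have wx: "signed S w \<bullet> x \<le> 0" using Wc[of x] by force
    have weight: "signed S w \<bullet> t > 0" using t w WA by auto
    \<comment> \<open>Up to scaling, the point where the segment from \<open>x\<close> to
      \<open>t\<close> meets \<open>w\<close>; the other members of \<open>W\<close> are positive
      there.\<close>
    define y where "y = (signed S w \<bullet> t) *\<^sub>R x + (- (signed S w \<bullet> x)) *\<^sub>R t"
    have yw: "signed S w \<bullet> y = 0" by (simp add: y_def inner_add_right inner_diff_right)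
    have yv: "signed S v \<bullet> y > 0" if "v \<in> W - {w}" for v
    proof -
      have "(signed S w \<bullet> t) * (signed S v \<bullet> x) > 0" using x that weight by simp
      moreover have "(- (signed S w \<bullet> x)) * (signed S v \<bullet> t) \<ge> 0"
        using wx t[of v] that WA by (intro mult_nonneg_nonneg) (auto intro: less_imp_le)
      ultimately show ?thesis unfolding y_def inner_add_right inner_scaleR_right by linarith
    qed
    have "signed S j \<bullet> y > 0" if j: "j \<in> A - {w}" for j
    proof (rule ccontr)
      assume "\<not> signed S j \<bullet> y > 0"
      moreover have "signed S j \<bullet> y \<ge> 0"
        using cl[of y j] yw yv j by (metis Diff_iff insert_iff less_imp_le order_refl singletonD)
      ultimately have j0: "signed S j \<bullet> y = 0" by simp
      \<comment> \<open>As \<open>j\<close> and \<open>w\<close> are not parallel, a small move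
        inside \<open>w\<close> makes \<open>j\<close> negative while all of \<open>W\<close> stays
        nonnegative, against \<open>cl\<close>.\<close>
      have "n j \<notin> span {n w}" using A j w WA by (auto simp: positive_def)
      moreover have "n j \<in> span {n w} \<longleftrightarrow> signed S j \<in> span {n w}"
        using span_neg[of "n j" "{n w}"] span_neg[of "- n j" "{n w}"] by (auto simp: signed_def)
      ultimately obtain u where u: "\<And>x. x \<in> span {n w} \<Longrightarrow> x \<bullet> u = 0" "signed S j \<bullet> u > 0"
        using orth_witness by metis
      have uw: "n w \<bullet> u = 0" using u(1) by (simp add: span_base)
      obtain e where e: "e > 0" "\<And>i. i \<in> A \<Longrightarrow> n i \<bullet> y > 0 \<Longrightarrow> n i \<bullet> (y + e *\<^sub>R (-u)) > 0"
        "\<And>i. i \<in> A \<Longrightarrow> n i \<bullet> y < 0 \<Longrightarrow> n i \<bullet> (y + e *\<^sub>R (-u)) < 0"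
        using perturb[OF positive_finite[OF A]] by metis
      have "signed S v \<bullet> (y + e *\<^sub>R (-u)) \<ge> 0" if v: "v \<in> W" for v
      proof (cases "v = w")
        case True
        then have "n w \<bullet> y = 0" using yw by (simp add: signed_zero_iff)
        then have "n w \<bullet> (y + e *\<^sub>R (-u)) = 0" using uw by (simp add: inner_add_right inner_diff_right)
        then show ?thesis using True by (metis order_refl signed_zero_iff)
      next
        case False
        then have "signed S v \<bullet> y > 0" using yv v by blast
        then have "signed S v \<bullet> (y + e *\<^sub>R (-u)) > 0"
          using e v WA unfolding signed_pos_iff by (auto split: if_splits)
        then show ?thesis by simp
      qed
      then have "signed S j \<bullet> (y + e *\<^sub>R (-u)) \<ge> 0" using cl j by blast
      moreover have "e * (signed S j \<bullet> u) > 0" using u(2) e(1) by simp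
      ultimately show False using j0 by (simp add: inner_add_right inner_diff_right)
    qed
    then show ?thesis using yw w WA by (auto simp: walls_def signed_zero_iff)
  qed
  then show ?thesis using that[of W] Wc by blast
qed

lemma sum_if_subset:
  "finite W \<Longrightarrow> K \<subseteq> W \<Longrightarrow> (\<Sum>w\<in>W. if w \<in> K then f w else 0) = (\<Sum>w\<in>K. f w)"
  by (simp add: sum.inter_restrict[symmetric] Int_absorb1)

lemma dual_point:
  assumes "simplicial A" "S \<in> sep_sets A"
  obtains x where "\<And>w. w \<in> walls A S \<Longrightarrow> signed S w \<bullet> x = \<phi> w"
proof -
  have "independent (n ` walls A S)" using assms by (simp add: simplicial_def)
  then obtain x where "\<And>w. w \<in> walls A S \<Longrightarrow> n w \<bullet> x = (if w \<in> S then - \<phi> w else \<phi> w)"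
    by (rule exists_linear_values[OF simplicial_good[OF assms(1)] walls_subset,
          where \<phi> = "\<lambda>w. if w \<in> S then - \<phi> w else \<phi> w"]) blast
  then have "signed S w \<bullet> x = \<phi> w" if "w \<in> walls A S" for w
    using that by (simp add: signed_def)
  then show ?thesis using that by blast
qed

text \<open>Farkas' lemma for a simplicial cone. A normal outside the span of the wall normals would
  be negative at some point where all walls vanish. Inside the span, the coefficient at
  \<open>v\<close> is the value at the vector dual to \<open>v\<close>, which lies in the closed
  cone.\<close>

lemma wall_coeffs:
  assumes A: "simplicial A" and S: "S \<in> sep_sets A" and i: "i \<in> A"
  obtains a where "\<And>w. a w \<ge> (0::real)" "signed S i = (\<Sum>w\<in>walls A S. a w *\<^sub>R signed S w)"
proof -
  note g = simplicial_good[OF A]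
  obtain t where t: "\<And>i. i \<in> A \<Longrightarrow> signed S i \<bullet> t > 0" using S by (auto simp: sep_sets_def)
  have cone: "signed S i \<bullet> x > 0" if "\<And>w. w \<in> walls A S \<Longrightarrow> signed S w \<bullet> x > 0" for x
    using region_open_cone[OF g S] that i by (metis subsetD)
  have fin: "finite (walls A S)" using finite_walls[OF g] .
  have far: "signed S i \<bullet> x \<ge> 0" if x: "\<And>w. w \<in> walls A S \<Longrightarrow> signed S w \<bullet> x \<ge> 0" for x
  proof (rule ccontr)
    assume neg: "\<not> signed S i \<bullet> x \<ge> 0"
    define e where "e = - (signed S i \<bullet> x) / (2 * (signed S i \<bullet> t))"
    have e: "e > 0" using neg t[OF i] by (simp add: e_def divide_neg_pos)
    have "signed S w \<bullet> (x + e *\<^sub>R t) > 0" if "w \<in> walls A S" for w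
    proof -
      have "e * (signed S w \<bullet> t) > 0" using t[of w] walls_subset[of A S] that e by auto
      then show ?thesis using x[OF that] by (simp add: inner_add_right)
    qed
    then have "signed S i \<bullet> (x + e *\<^sub>R t) > 0" using cone by blast
    moreover have "e * (signed S i \<bullet> t) = - (signed S i \<bullet> x) / 2"
      using t[OF i] by (simp add: e_def)
    ultimately show False using neg by (simp add: inner_add_right)
  qed
  have ex: "\<exists>x. \<forall>w\<in>walls A S. signed S w \<bullet> x = \<phi> w" for \<phi>
    using dual_point[OF A S] by metis
  have sp: "signed S i \<in> span (signed S ` walls A S)"
  proof (rule ccontr)
    assume "signed S i \<notin> span (signed S ` walls A S)"
    then obtain u where u: "\<And>x. x \<in> span (signed S ` walls A S) \<Longrightarrow> x \<bullet> u = 0" "signed S i \<bullet> u > 0"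
      using orth_witness by metis
    have "signed S i \<bullet> (- u) \<ge> 0"
      by (rule far) (simp add: u(1) span_base)
    then show False using u(2) by simp
  qed
  have "\<exists>a. signed S i = (\<Sum>w\<in>walls A S. a w *\<^sub>R signed S w)"
  proof -
    have inj: "inj_on (signed S) (walls A S)"
    proof (rule inj_onI)
      fix v w assume vw: "v \<in> walls A S" "w \<in> walls A S" "signed S v = signed S w"
      obtain x where "\<forall>u\<in>walls A S. signed S u \<bullet> x = (if u = v then 1 else 0)" using ex[of "\<lambda>u. if u = v then 1 else 0"] by blast
      then show "v = w" using vw by (metis zero_neq_one)
    qed
    obtain c where c: "signed S i = (\<Sum>v\<in>signed S ` walls A S. c v *\<^sub>R v)"
      using sp fin by (auto simp: span_finite)
    then show ?thesis by (auto simp: sum.reindex[OF inj])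
  qed
  then obtain a where a: "signed S i = (\<Sum>w\<in>walls A S. a w *\<^sub>R signed S w)" by blast
  have a0: "a v \<ge> 0" if v: "v \<in> walls A S" for v
  proof -
    obtain x where x: "\<forall>u\<in>walls A S. signed S u \<bullet> x = (if u = v then 1 else 0)" using ex[of "\<lambda>u. if u = v then 1 else 0"] by blast
    have "signed S i \<bullet> x = (\<Sum>w\<in>walls A S. a w * (signed S w \<bullet> x))"
      by (simp add: a inner_sum_left)
    also have "\<dots> = (\<Sum>w\<in>walls A S. if w = v then a w else 0)"
      by (rule sum.cong) (auto simp: x)
    also have "\<dots> = a v" using v fin by simp
    finally show ?thesis using far[of x] x by auto
  qed
  \<comment> \<open>Coefficients off the walls are set to 0, so nonnegativity holds without a side
    condition.\<close>
  show ?thesis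
    by (rule that[of "\<lambda>w. if w \<in> walls A S then a w else 0"]) (use a0 a in \<open>auto intro: sum.cong\<close>)
qed

section \<open>Faces, localizations and cuts\<close>

lemma walls_indep: "simplicial A \<Longrightarrow> S \<in> sep_sets A \<Longrightarrow> independent (n ` walls A S)"
  by (simp add: simplicial_def)

lemma span_orth: "v \<in> span V \<Longrightarrow> (\<And>u. u \<in> V \<Longrightarrow> u \<bullet> x = 0) \<Longrightarrow> v \<bullet> (x::'a) = 0"
  by (induction rule: span_induct_alt) (auto simp: inner_add_left)

lemma flat_orth: "i \<in> flat A K \<Longrightarrow> (\<And>k. k \<in> K \<Longrightarrow> n k \<bullet> x = 0) \<Longrightarrow> n i \<bullet> x = 0"
  unfolding flat_def by (auto intro: span_orth)

text \<open>Walls in terms of sign vectors, the form in which \<open>compose\<close> delivers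
  points.\<close>

lemma walls_iff:
  assumes "S \<subseteq> A"
  shows "i \<in> walls A S \<longleftrightarrow> (\<exists>x. zero A x = {i} \<and> neg A x = S - {i})"
proof
  assume "i \<in> walls A S"
  then obtain x where "i \<in> A" "n i \<bullet> x = 0" "\<forall>j\<in>A - {i}. signed S j \<bullet> x > 0"
    by (auto simp: walls_def)
  then have "zero A x = {i} \<and> neg A x = S - {i}"
    using assms unfolding zero_def neg_def signed_pos_iff
    by (intro conjI set_eqI) (force split: if_splits)+
  then show "\<exists>x. zero A x = {i} \<and> neg A x = S - {i}" by blast
next
  assume "\<exists>x. zero A x = {i} \<and> neg A x = S - {i}"
  then obtain x where x: "zero A x = {i}" "neg A x = S - {i}" by blast
  have 1: "i \<in> A" "n i \<bullet> x = 0" using x(1) by (auto simp: zero_def)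
  have "signed S j \<bullet> x > 0" if j: "j \<in> A - {i}" for j
  proof -
    have "n j \<bullet> x \<noteq> 0" using x(1) j by (auto simp: zero_def)
    moreover have "n j \<bullet> x < 0 \<longleftrightarrow> j \<in> S" using x(2) j by (auto simp: neg_def)
    ultimately show ?thesis unfolding signed_pos_iff by auto
  qed
  then show "i \<in> walls A S" using 1 by (auto simp: walls_def)
qed

lemma walls_restrict: "i \<in> walls A S \<Longrightarrow> i \<in> A' \<Longrightarrow> A' \<subseteq> A \<Longrightarrow> i \<in> walls A' (S \<inter> A')"
  unfolding walls_def signed_pos_iff by (fastforce split: if_splits)

lemma basic_restrict: "i \<in> basic A \<Longrightarrow> i \<in> A' \<Longrightarrow> A' \<subseteq> A \<Longrightarrow> i \<in> basic A'"
  using walls_restrict[of i A "{}" A'] by simp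

lemma zero_zero: "A' \<subseteq> A \<Longrightarrow> zero A' x = zero A x \<inter> A'"
  by (auto simp: zero_def)

lemma neg_neg: "A' \<subseteq> A \<Longrightarrow> neg A' x = neg A x \<inter> A'"
  by (auto simp: neg_def)

lemma walls_opposite:
  assumes "S \<subseteq> A"
  shows "walls A (A - S) = walls A S"
proof -
  have *: "walls A S \<subseteq> walls A (A - S)" if "S \<subseteq> A" for S
  proof
    fix i assume "i \<in> walls A S"
    then obtain x where x: "i \<in> A" "n i \<bullet> x = 0" "\<forall>j\<in>A - {i}. signed S j \<bullet> x > 0"
      by (auto simp: walls_def)
    then have "n i \<bullet> (-x) = 0" "\<forall>j\<in>A - {i}. signed (A - S) j \<bullet> (-x) > 0"
      unfolding signed_pos_iff by auto
    then show "i \<in> walls A (A - S)" using x(1) unfolding walls_def by blast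
  qed
  show ?thesis using *[OF assms] *[of "A - S"] assms by (auto simp: double_diff)
qed

lemma sep_sets_opposite:
  assumes "S \<in> sep_sets A"
  shows "A - S \<in> sep_sets A"
proof -
  obtain x where "\<forall>i\<in>A. signed S i \<bullet> x > 0" using assms by (auto simp: sep_sets_def)
  then have "\<forall>i\<in>A. signed (A - S) i \<bullet> (-x) > 0" unfolding signed_pos_iff by auto
  then show ?thesis unfolding sep_sets_def by blast
qed

lemma full_sep_sets: "positive A \<Longrightarrow> A \<in> sep_sets A"
  using sep_sets_opposite[OF empty_sep_sets] by simp

text \<open>A short step from \<open>z\<close> into a region of the localization leaves the signs of
  all hyperplanes off \<open>z\<close> unchanged.\<close>

lemma star_sep_sets:
  assumes "positive A" "S \<in> sep_sets (zero A z)"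
  shows "neg A z \<union> S \<in> sep_sets A"
proof -
  obtain x where x: "zero (zero A z) x = {}" "neg (zero A z) x = S"
    using assms(2) by (auto simp: sep_sets_iff)
  obtain y where "zero A y = zero A z \<inter> zero A x" "neg A y = neg A z \<union> (zero A z \<inter> neg A x)"
    using compose[OF positive_finite[OF assms(1)]] .
  then have "zero A y = {}" "neg A y = neg A z \<union> S"
    using x zero_zero[OF zero_subset, of A z x] neg_neg[OF zero_subset, of A z x] by auto
  then show ?thesis by (auto simp: sep_sets_iff)
qed

lemma sep_sets_restrict: "S \<in> sep_sets A \<Longrightarrow> A' \<subseteq> A \<Longrightarrow> S \<inter> A' \<in> sep_sets A'"
  unfolding sep_sets_iff using zero_zero neg_neg by (metis inf_bot_left)

lemma neg_zero_disjoint: "neg A z \<inter> zero A z = {}"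
  by (auto simp: neg_def zero_def)

text \<open>The last hypothesis says that \<open>z\<close> lies in the closed region
  \<open>S\<close>. Being a wall is local at \<open>z\<close>: a facet point of the local cone
  becomes one of \<open>S\<close> when approached from \<open>z\<close> by a short step.\<close>

lemma walls_star:
  assumes "positive A" "S \<in> sep_sets A" "S - zero A z = neg A z"
  shows "walls (zero A z) (S \<inter> zero A z) = walls A S \<inter> zero A z"
proof
  show "walls A S \<inter> zero A z \<subseteq> walls (zero A z) (S \<inter> zero A z)"
    using walls_restrict zero_subset by blast
  show "walls (zero A z) (S \<inter> zero A z) \<subseteq> walls A S \<inter> zero A z"
  proof
    fix i assume i: "i \<in> walls (zero A z) (S \<inter> zero A z)"
    then obtain x where x: "zero (zero A z) x = {i}" "neg (zero A z) x = S \<inter> zero A z - {i}"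
      using walls_iff[of "S \<inter> zero A z" "zero A z"] by auto
    have iz: "i \<in> zero A z" using i walls_subset by blast
    obtain y where "zero A y = zero A z \<inter> zero A x" "neg A y = neg A z \<union> (zero A z \<inter> neg A x)"
      using compose[OF positive_finite[OF assms(1)]] .
    then have y: "zero A y = {i}" "neg A y = neg A z \<union> (S \<inter> zero A z - {i})"
      using x zero_zero[OF zero_subset, of A z x] neg_neg[OF zero_subset, of A z x]
      by (simp_all add: Int_commute)
    have "neg A y = S - {i}" using y(2) assms(3) iz neg_zero_disjoint[of A z] by blast
    note y = y(1) this
    then show "i \<in> walls A S \<inter> zero A z"
      using iz walls_iff[OF sep_sets_subset[OF assms(2)]] by auto
  qed
qed

lemma simplicial_zero:
  assumes "simplicial A"
  shows "simplicial (zero A z)"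
  unfolding simplicial_def
proof (intro conjI ballI)
  show g: "positive (zero A z)" using simplicial_good[OF assms] positive_subset zero_subset by blast
  fix S assume S: "S \<in> sep_sets (zero A z)"
  have SA: "neg A z \<union> S \<in> sep_sets A" by (rule star_sep_sets[OF simplicial_good[OF assms] S])
  have "walls (zero A z) S \<subseteq> walls A (neg A z \<union> S)"
    using walls_star[OF simplicial_good[OF assms] SA, of z] sep_sets_subset[OF S] neg_zero_disjoint[of A z]
    by (simp add: Int_Un_distrib2 Int_absorb2 Un_Diff Diff_triv) (metis Diff_eq_empty_iff Int_subset_iff eq_refl sup_bot.right_neutral)
  then show "independent (n ` walls (zero A z) S)"
    using walls_indep[OF assms SA] independent_mono image_mono by metis
qed

text \<open>The values 0 on \<open>K\<close> and 1 on the other walls put \<open>w\<close> in the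
  relative interior of the face cut out by \<open>K\<close>. If a normal vanishes at
  \<open>w\<close>, its nonnegative coefficients outside \<open>K\<close> sum to zero, hence are all
  zero; this identifies the localization at \<open>w\<close> and gives the combinations over
  \<open>K\<close> alone.\<close>

lemma face_coeffs:
  assumes A: "simplicial A" and S: "S \<in> sep_sets A" and K: "K \<subseteq> walls A S"
  obtains w where "\<And>k. k \<in> walls A S \<Longrightarrow> signed S k \<bullet> w = (if k \<in> K then 0 else 1)"
    "zero A w = flat A K" "neg A w = S - flat A K"
    "\<And>i. i \<in> flat A K \<Longrightarrow> \<exists>a. (\<forall>k. a k \<ge> (0::real)) \<and> signed S i = (\<Sum>k\<in>K. a k *\<^sub>R signed S k)"
proof -
  obtain w where w: "\<And>k. k \<in> walls A S \<Longrightarrow> signed S k \<bullet> w = (if k \<in> K then 0 else 1)"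
    using dual_point[OF A S, where \<phi> = "\<lambda>k. if k \<in> K then 0 else 1"] by metis
  have fin: "finite (walls A S)" using finite_walls[OF simplicial_good[OF A]] .
  have main: "signed S i \<bullet> w \<ge> 0 \<and> (signed S i \<bullet> w = 0 \<longleftrightarrow> i \<in> flat A K) \<and>
      (i \<in> flat A K \<longrightarrow> (\<exists>a. (\<forall>k. a k \<ge> (0::real)) \<and> signed S i = (\<Sum>k\<in>K. a k *\<^sub>R signed S k)))"
    if i: "i \<in> A" for i
  proof -
    obtain a where a: "\<And>w. a w \<ge> (0::real)" "signed S i = (\<Sum>w\<in>walls A S. a w *\<^sub>R signed S w)"
      using wall_coeffs[OF A S i] by blast
    have eq: "signed S i \<bullet> w = (\<Sum>k\<in>walls A S. if k \<in> K then 0 else a k)"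
      unfolding a(2) inner_sum_left by (rule sum.cong) (auto simp: w)
    have ge: "signed S i \<bullet> w \<ge> 0" unfolding eq by (rule sum_nonneg) (simp add: a)
    have "i \<in> flat A K" if "i \<in> flat A K \<or> signed S i \<bullet> w = 0"
    proof (cases "i \<in> flat A K")
      case False
      then have "signed S i \<bullet> w = 0" using that by blast
      then have a0: "\<forall>k\<in>walls A S. (if k \<in> K then 0 else a k) = 0"
        unfolding eq by (subst (asm) sum_nonneg_eq_0_iff[OF fin]) (auto simp: a)
      have "signed S i = (\<Sum>k\<in>walls A S. if k \<in> K then a k *\<^sub>R signed S k else 0)"
        unfolding a(2) by (rule sum.cong) (use a0 in auto)
      also have "\<dots> = (\<Sum>k\<in>K. a k *\<^sub>R signed S k)" using sum_if_subset[OF fin K] .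
      also have "\<dots> \<in> span (n ` K)"
        by (rule span_sum, rule span_scale) (auto simp: signed_def span_base intro: span_neg)
      finally have "n i \<in> span (n ` K)"
        using span_neg[of "- n i" "n ` K"] by (auto simp: signed_def split: if_splits)
      then show ?thesis using i by (simp add: flat_def)
    qed
    moreover have "signed S i \<bullet> w = 0" if "i \<in> flat A K"
    proof -
      have "n k \<bullet> w = 0" if "k \<in> K" for k
        using w[of k] K that signed_zero_iff[of S k w] by auto
      then show ?thesis using flat_orth[OF that, of w] by (simp add: signed_zero_iff)
    qed
    moreover have "\<exists>a. (\<forall>k. a k \<ge> (0::real)) \<and> signed S i = (\<Sum>k\<in>K. a k *\<^sub>R signed S k)" if "i \<in> flat A K"
    proof -
      have "signed S i \<bullet> w = 0" using calculation that by blast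
      then have a0: "\<forall>k\<in>walls A S. (if k \<in> K then 0 else a k) = 0"
        unfolding eq by (subst (asm) sum_nonneg_eq_0_iff[OF fin]) (auto simp: a)
      have "signed S i = (\<Sum>k\<in>walls A S. if k \<in> K then a k *\<^sub>R signed S k else 0)"
        unfolding a(2) by (rule sum.cong) (use a0 in auto)
      also have "\<dots> = (\<Sum>k\<in>K. a k *\<^sub>R signed S k)" using sum_if_subset[OF fin K] .
      finally show ?thesis using a(1) by blast
    qed
    ultimately show ?thesis using ge by blast
  qed
  have 1: "zero A w = flat A K"
    using main flat_subset by (fastforce simp: zero_def signed_zero_iff)
  have 2: "neg A w = S - flat A K"
  proof -
    have "n i \<bullet> w < 0 \<longleftrightarrow> i \<in> S - flat A K" if "i \<in> A" for i
      using main[OF that] by (auto simp: signed_def split: if_splits)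
    then show ?thesis using sep_sets_subset[OF S] by (auto simp: neg_def)
  qed
  show ?thesis using that[OF w 1 2] main flat_subset by blast
qed

lemma face:
  assumes "simplicial A" "S \<in> sep_sets A" "K \<subseteq> walls A S"
  obtains w where "zero A w = flat A K" "neg A w = S - flat A K"
  using face_coeffs[OF assms] by metis

text \<open>No further wall contains the face cut out by \<open>K\<close>, so \<open>K\<close> can
  be read off from the face.\<close>

lemma walls_Int_flat:
  assumes "simplicial A" "S \<in> sep_sets A" "K \<subseteq> walls A S"
  shows "walls A S \<inter> flat A K = K"
proof -
  obtain w where w: "\<And>k. k \<in> walls A S \<Longrightarrow> signed S k \<bullet> w = (if k \<in> K then 0 else 1)"
    "zero A w = flat A K"
    using face_coeffs[OF assms] by metis
  have "k \<in> K" if "k \<in> walls A S" "k \<in> flat A K" for k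
  proof -
    have "signed S k \<bullet> w = 0" using that(2) w(2) by (auto simp: zero_def signed_zero_iff)
    then show ?thesis using w(1)[OF that(1)] by (auto split: if_splits)
  qed
  then show ?thesis using assms(3) flat_base walls_subset by (meson Int_greatest Int_iff subsetI subset_antisym subset_trans)
qed

text \<open>If some \<open>i\<close> did not separate, its normal, positive at \<open>b\<close>,
  would be a nonnegative combination of signed wall normals that are all negative at
  \<open>b\<close>.\<close>

lemma all_lower:
  assumes A: "simplicial A" and S: "S \<in> sep_sets A" and "walls A S \<subseteq> S"
  shows "S = A"
proof (rule ccontr)
  assume "S \<noteq> A"
  then obtain i where i: "i \<in> A" "i \<notin> S" using sep_sets_subset[OF S] by blast
  obtain a where a: "\<And>w. a w \<ge> (0::real)" "signed S i = (\<Sum>w\<in>walls A S. a w *\<^sub>R signed S w)"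
    using wall_coeffs[OF A S i(1)] by blast
  have "signed S i \<bullet> b = (\<Sum>w\<in>walls A S. a w * (signed S w \<bullet> b))" by (simp add: a(2) inner_sum_left)
  also have "\<dots> \<le> 0"
  proof (rule sum_nonpos)
    fix w assume w: "w \<in> walls A S"
    then have "signed S w \<bullet> b < 0" using assms(3) positive_pos[OF simplicial_good[OF A]] walls_subset
      by (metis inner_minus_left neg_less_0_iff_less signed_def subsetD)
    then show "a w * (signed S w \<bullet> b) \<le> 0" using a(1) by (simp add: mult_nonneg_nonpos)
  qed
  finally show False using i positive_pos[OF simplicial_good[OF A] i(1)] by (simp add: signed_def)
qed

lemma all_upper:
  assumes A: "simplicial A" and S: "S \<in> sep_sets A" and "walls A S \<inter> S = {}"
  shows "S = {}"
  using all_lower[OF A sep_sets_opposite[OF S]] walls_opposite[OF sep_sets_subset[OF S]] assms(3)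
    walls_subset sep_sets_subset[OF S] by blast

text \<open>In the localization at the face cut out by \<open>K\<close>, the region \<open>S\<close>
  has exactly the walls \<open>K\<close>, all lower. So it is opposite to the base region there, and
  opposite regions have the same walls.\<close>

lemma basic_flat:
  assumes A: "simplicial A" and S: "S \<in> sep_sets A" and K: "K \<subseteq> lower_walls A S"
  shows "basic (flat A K) = K" "flat A K \<subseteq> S"
proof -
  obtain w where w: "zero A w = flat A K" "neg A w = S - flat A K"
    using face[OF A S] K by (metis le_inf_iff)
  have loc: "walls (flat A K) (S \<inter> flat A K) = K"
    using walls_star[OF simplicial_good[OF A] S, of w] walls_Int_flat[OF A S, of K] w K by simp
  have "K \<subseteq> flat A K" using K flat_base[of K A] walls_subset[of A S] by blast
  then have "S \<inter> flat A K = flat A K"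
    by (intro all_lower)
      (use simplicial_zero[OF A, of w] sep_sets_restrict[OF S flat_subset] w loc K in auto)
  then show "basic (flat A K) = K" "flat A K \<subseteq> S"
    using loc walls_opposite[of "{}" "flat A K"] by auto
qed

lemma flat_basic: "simplicial A \<Longrightarrow> flat A (basic A) = A"
proof
  assume A: "simplicial A"
  show "A \<subseteq> flat A (basic A)"
  proof
    fix i assume i: "i \<in> A"
    obtain a where a: "signed {} i = (\<Sum>w\<in>basic A. a w *\<^sub>R signed {} w)"
      using wall_coeffs[OF A empty_sep_sets[OF simplicial_good[OF A]] i] by metis
    have "n i = (\<Sum>w\<in>basic A. a w *\<^sub>R n w)" using a by (simp add: signed_def)
    also have "\<dots> \<in> span (n ` basic A)" by (intro span_sum span_scale span_base imageI)
    finally show "i \<in> flat A (basic A)" using i by (simp add: flat_def)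
  qed
qed (rule flat_subset)

text \<open>The localization at a point is recovered from its basic hyperplanes, so a set of basic
  hyperplanes can serve as the label of a flat.\<close>

lemma flat_basic_zero:
  assumes "simplicial A"
  shows "flat A (basic (zero A q)) = zero A q"
proof
  show "zero A q \<subseteq> flat A (basic (zero A q))"
    using flat_basic[OF simplicial_zero[OF assms]] zero_subset unfolding flat_def by blast
  show "flat A (basic (zero A q)) \<subseteq> zero A q"
  proof
    fix i assume i: "i \<in> flat A (basic (zero A q))"
    have "n i \<bullet> q = 0"
      by (rule flat_orth[OF i]) (use walls_subset in \<open>force simp: zero_def\<close>)
    then show "i \<in> zero A q" using i by (simp add: flat_def zero_def)
  qed
qed

text \<open>A generic point of the intersection of \<open>K\<close>: each hyperplane outside the
  flat is left in turn by composing with a vector orthogonal to the normals of \<open>K\<close> but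
  not to its own normal.\<close>

lemma flat_eq_zero:
  assumes "finite A" "K \<subseteq> A"
  obtains z where "zero A z = flat A K"
proof -
  have "\<exists>z. flat A K \<subseteq> zero A z \<and> zero A z \<inter> F \<subseteq> flat A K" if "finite F" "F \<subseteq> A" for F
    using that
  proof (induction F)
    case empty
    then show ?case by (intro exI[of _ 0]) (auto simp: zero_def flat_def)
  next
    case (insert i F)
    then obtain z where z: "flat A K \<subseteq> zero A z" "zero A z \<inter> F \<subseteq> flat A K" by auto
    show ?case
    proof (cases "i \<in> flat A K")
      case True
      then show ?thesis using z by blast
    next
      case False
      then have "n i \<notin> span (n ` K)" using insert.prems by (simp add: flat_def)
      then obtain u where u: "\<And>v. v \<in> span (n ` K) \<Longrightarrow> v \<bullet> u = 0" "n i \<bullet> u > 0"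
        using orth_witness by metis
      have uf: "flat A K \<subseteq> zero A u" "i \<notin> zero A u" using u by (auto simp: flat_def zero_def)
      obtain x where "zero A x = zero A z \<inter> zero A u" using compose[OF assms(1)] by metis
      then show ?thesis using z uf by (intro exI[of _ x]) auto
    qed
  qed
  from this[OF assms(1) subset_refl] show ?thesis
    using that zero_subset by (metis Int_absorb2 subset_antisym)
qed

section \<open>Cuts and basic hyperplanes\<close>

lemma flat_zero_pair: "i \<in> zero A z \<Longrightarrow> j \<in> zero A z \<Longrightarrow> flat (zero A z) {i, j} = flat A {i, j}"
proof -
  assume "i \<in> zero A z" "j \<in> zero A z"
  then have "flat A {i, j} \<subseteq> zero A z"
    using flat_orth[of _ A "{i,j}" z] flat_subset[of A "{i,j}"] by (auto simp: zero_def)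
  then show ?thesis by (auto simp: flat_def zero_def)
qed

text \<open>Cutting is decided in a rank-two localization, which is the same in \<open>A\<close> and
  in the localization at any point on both hyperplanes.\<close>

lemma cut_zero: "i \<in> zero A z \<Longrightarrow> j \<in> zero A z \<Longrightarrow> cut (zero A z) i j \<longleftrightarrow> cut A i j"
proof -
  assume ij: "i \<in> zero A z" "j \<in> zero A z"
  then have "i \<in> A" "j \<in> A" using zero_subset by blast+
  then show ?thesis using ij by (simp add: cut_def flat_zero_pair)
qed

lemma basic_uncut: "i \<in> basic A \<Longrightarrow> \<not> cut A j i"
  unfolding cut_def using basic_restrict[of i A "flat A {j,i}"] flat_subset[of A "{j,i}"]
    flat_base[of "{j,i}" A] by blast

text \<open>Any basic \<open>k\<close> of the rank-two localization will do: it is not parallel to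
  \<open>j\<close>, so the normals of \<open>k\<close> and \<open>j\<close> span the same plane as
  those of \<open>i\<close> and \<open>j\<close>, and both pairs have the same localization.\<close>

lemma nonbasic_cut:
  assumes A: "simplicial A" and ij: "i \<in> A" "j \<in> A" "i \<noteq> j" and nb: "j \<notin> basic (flat A {i, j})"
  obtains k where "cut A k j" "k \<in> flat A {i, j}"
proof -
  obtain z where z: "zero A z = flat A {i, j}"
    using flat_eq_zero[OF positive_finite[OF simplicial_good[OF A]], of "{i,j}"] ij by auto
  have s: "simplicial (flat A {i, j})" using simplicial_zero[OF A, of z] z by simp
  have iin: "i \<in> flat A {i, j}" using flat_base[of "{i,j}" A] ij by auto
  have "basic (flat A {i, j}) \<noteq> {}"
  proof
    assume "basic (flat A {i, j}) = {}"
    then have "n i = 0" using flat_basic[OF s] iin unfolding flat_def by auto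
    then show False using positive_pos[OF simplicial_good[OF A] ij(1)] by simp
  qed
  then obtain k where k: "k \<in> basic (flat A {i, j})" by blast
  have kf: "k \<in> flat A {i, j}" using k walls_subset by blast
  have kj: "k \<noteq> j" using k nb by blast
  have kA: "k \<in> A" using kf flat_subset by blast
  have nk: "n k \<in> span (insert (n i) {n j})" using kf by (simp add: flat_def)
  have "n k \<notin> span {n j}" using simplicial_good[OF A] kA ij kj by (auto simp: positive_def)
  then have ni: "n i \<in> span (insert (n k) {n j})" using in_span_insert[OF nk] by simp
  have "span {n k, n j} = span {n i, n j}"
    using nk ni by (simp add: span_eq span_base)
  then have "flat A {k, j} = flat A {i, j}" by (simp add: flat_def)
  then have "cut A k j" using k kA ij kj nb by (simp add: cut_def)
  then show ?thesis using that kf by blast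
qed

lemma flat_singleton: "positive A \<Longrightarrow> i \<in> A \<Longrightarrow> flat A {i} = {i}"
  unfolding flat_def positive_def by (auto simp: span_base)

text \<open>Take a generic point of \<open>i\<close> with fewest hyperplanes between it and \<open>b\<close>. If some remain, the
  region in front of it has a lower wall \<open>W\<close>, and since \<open>i\<close> is basic in the rank-two localization at
  \<open>i \<inter> W\<close>, crossing \<open>W\<close> inside \<open>i\<close> only removes hyperplanes.\<close>

lemma uncut_basic:
  assumes A: "simplicial A" and i: "i \<in> A" and uncut: "\<And>j. \<not> cut A j i"
  shows "i \<in> basic A"
proof -
  note g = simplicial_good[OF A]
  have "\<exists>x. zero A x = {i}"
    using flat_eq_zero[OF positive_finite[OF g], of "{i}"] flat_singleton[OF g i] i
    by (metis empty_subsetI insert_subset)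
  then obtain x where x: "zero A x = {i}" "\<And>y. zero A y = {i} \<Longrightarrow> card (neg A x) \<le> card (neg A y)"
    using exists_least_iff[of "\<lambda>k. \<exists>x. zero A x = {i} \<and> card (neg A x) = k"] by (metis not_less)
  define T where "T = neg A x"
  have inT: "i \<notin> T" using x(1) by (auto simp: T_def neg_def zero_def)
  have T: "T \<in> sep_sets A"
  proof -
    have "{} \<in> sep_sets (zero A x)" using empty_sep_sets positive_subset[OF g zero_subset] by blast
    then show ?thesis using star_sep_sets[OF g, of "{}" x] by (simp add: T_def)
  qed
  have iw: "i \<in> walls A T"
    using walls_iff[OF sep_sets_subset[OF T]] x(1) inT T_def by (metis Diff_empty Diff_insert0)
  have "T = {}"
  proof (rule ccontr)
    assume "T \<noteq> {}"
    then obtain W where W: "W \<in> walls A T" "W \<in> T" using all_upper[OF A T] by blast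
    obtain w where w: "zero A w = flat A {i, W}" "neg A w = T - flat A {i, W}"
      using face[OF A T, of "{i, W}"] iw W by auto
    have WA: "W \<in> A" "W \<noteq> i" using W inT sep_sets_subset[OF T] by auto
    have "i \<in> basic (flat A {W, i})"
      using nonbasic_cut[OF A WA(1) i WA(2)] uncut by blast
    then have "i \<in> basic (flat A {i, W})" by (simp add: insert_commute)
    then obtain y where y: "zero (flat A {i, W}) y = {i}" "neg (flat A {i, W}) y = {}"
      using walls_iff[of "{}" "flat A {i, W}" i] by auto
    obtain v where "zero A v = zero A w \<inter> zero A y" "neg A v = neg A w \<union> (zero A w \<inter> neg A y)"
      using compose[OF positive_finite[OF g]] .
    then have v: "zero A v = {i}" "neg A v = T - flat A {i, W}"
      using y w zero_zero[OF flat_subset, of A "{i,W}" y] neg_neg[OF flat_subset, of A "{i,W}" y] by auto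
    have "W \<in> flat A {i, W}" using flat_base[of "{i,W}" A] i WA by auto
    then have "T - flat A {i, W} \<subset> T" using W by auto
    then have "card (neg A v) < card (neg A x)"
      using v(2) psubset_card_mono finite_subset[OF sep_sets_subset[OF T] positive_finite[OF g]] by (simp add: T_def)
    then show False using x(2)[OF v(1)] by simp
  qed
  then show ?thesis using iw by simp
qed

text \<open>Basic hyperplanes of \<open>A\<close> are walls of the base region, so the flat of
  \<open>q\<close> is spanned by one of its faces; \<open>y\<close> is a generic point of that
  face.\<close>

lemma positive_point:
  assumes "simplicial A" "basic (zero A q) \<subseteq> basic A"
  obtains y where "zero A y = zero A q" "neg A y = {}"
  using face[OF assms(1) empty_sep_sets[OF simplicial_good[OF assms(1)]] assms(2)]
    flat_basic_zero[OF assms(1), of q] by (metis empty_Diff)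

section \<open>Regions and classes of points\<close>

text \<open>Among the regions containing \<open>c\<close>, this is the one farthest from the base.
  Near \<open>c\<close> it is opposite to the base region, so its walls through \<open>c\<close> are
  the basic hyperplanes of the localization, and all are lower.\<close>

lemma top_sep_sets:
  assumes "simplicial A"
  shows "neg A c \<union> zero A c \<in> sep_sets A"
    and "basic (zero A c) = walls A (neg A c \<union> zero A c) \<inter> zero A c"
proof -
  note g = simplicial_good[OF assms]
  show R: "neg A c \<union> zero A c \<in> sep_sets A"
    using star_sep_sets[OF g full_sep_sets[OF positive_subset[OF g zero_subset]]] .
  have "walls (zero A c) (zero A c) = walls A (neg A c \<union> zero A c) \<inter> zero A c"
    using walls_star[OF g R, of c] neg_zero_disjoint[of A c]
    by (simp add: Un_Diff Diff_triv Int_Un_distrib2)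
  then show "basic (zero A c) = walls A (neg A c \<union> zero A c) \<inter> zero A c"
    using walls_opposite[of "{}" "zero A c"] by simp
qed

text \<open>At the face cut out by \<open>K\<close> the top region of \<open>c\<close> is locally
  opposite to the base. Composing a point \<open>w\<close> of that face with \<open>-c\<close> makes
  every hyperplane of \<open>flat A K\<close> nonnegative and keeps those through \<open>c\<close>.
  A basic hyperplane of \<open>c\<close> stays basic in \<open>flat A K\<close>, so none of the
  crossed hyperplanes cuts it, and the class does not change.\<close>

lemma descend:
  assumes A: "simplicial A" and K: "basic (zero A c) \<subseteq> K" "K \<subseteq> lower_walls A (neg A c \<union> zero A c)"
  obtains m where "zero A m = zero A c" "neg A m = neg A c - flat A K"
    "\<And>i j. i \<in> basic (zero A c) \<Longrightarrow> cut A j i \<Longrightarrow> j \<notin> flat A K"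
proof -
  note g = simplicial_good[OF A]
  let ?T = "neg A c \<union> zero A c"
  have T: "?T \<in> sep_sets A" using top_sep_sets[OF A] by blast
  obtain w where w: "zero A w = flat A K" "neg A w = ?T - flat A K"
    using face[OF A T, of K] K by (metis le_inf_iff)
  have bf: "basic (flat A K) = K" "flat A K \<subseteq> ?T" using basic_flat[OF A T K(2)] by auto
  have zf: "zero A c \<subseteq> flat A K"
    using flat_basic_zero[OF A, of c] flat_mono[OF K(1), of A] by simp
  obtain m where m: "zero A m = zero A w \<inter> zero A (-c)" "neg A m = neg A w \<union> (zero A w \<inter> neg A (-c))"
    using compose[OF positive_finite[OF g]] .
  have zc: "zero A (-c) = zero A c" by (simp add: zero_def)
  have nc: "neg A (-c) \<inter> ?T = {}" by (auto simp: zero_def neg_def)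
  have "zero A m = zero A c" using m w zc zf by auto
  moreover have "neg A m = neg A c - flat A K" using m w nc zf bf(2) by auto
  moreover have "j \<notin> flat A K" if i: "i \<in> basic (zero A c)" and ji: "cut A j i" for i j
  proof
    assume j: "j \<in> flat A K"
    have "i \<in> basic (flat A K)" using i K bf by auto
    then have "\<not> cut (zero A w) j i" using basic_uncut[of i "flat A K" j] w by simp
    moreover have "i \<in> zero A w" "j \<in> zero A w" using i j w zf walls_subset by blast+
    ultimately show False using cut_zero[of j A w i] ji by simp
  qed
  ultimately show ?thesis using that by blast
qed

text \<open>The class labelled by the basic hyperplanes \<open>L\<close> and the signs
  \<open>N\<close> of their cutters. Unlike in an equivalence class proper, a point may lie on
  further hyperplanes that cut no member of \<open>L\<close>; this makes the set convex.\<close>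

definition cell :: "'i set \<Rightarrow> 'i set \<Rightarrow> 'i set \<Rightarrow> 'a set" where
  "cell A L N = {z. (\<forall>i\<in>L. n i \<bullet> z = 0) \<and> (\<forall>i\<in>L. \<forall>j. cut A j i \<longrightarrow> signed N j \<bullet> z > 0)}"

lemma cut_in: "cut A j i \<Longrightarrow> j \<in> A"
  by (simp add: cut_def)

lemma cell_transfer:
  assumes "z \<in> cell A L N" "\<And>i. i \<in> L \<Longrightarrow> n i \<bullet> m = 0"
    "\<And>i j. i \<in> L \<Longrightarrow> cut A j i \<Longrightarrow> j \<notin> zero A m \<and> (j \<in> neg A m \<longleftrightarrow> j \<in> neg A z)"
  shows "m \<in> cell A L N"
proof -
  have "signed N j \<bullet> m > 0" if "i \<in> L" "cut A j i" for i j
  proof -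
    have "signed N j \<bullet> z > 0" using assms(1) that by (auto simp: cell_def)
    moreover have "n j \<bullet> m \<noteq> 0" "n j \<bullet> m < 0 \<longleftrightarrow> n j \<bullet> z < 0"
      using assms(3)[OF that] cut_in[OF that(2)] by (auto simp: zero_def neg_def)
    ultimately show ?thesis unfolding signed_pos_iff by (auto split: if_splits)
  qed
  then show ?thesis using assms(2) by (auto simp: cell_def)
qed

lemma descend_cell:
  assumes A: "simplicial A" and K: "basic (zero A c) \<subseteq> K" "K \<subseteq> lower_walls A (neg A c \<union> zero A c)"
    and c: "c \<in> cell A (basic (zero A c)) N"
  obtains m where "zero A m = zero A c" "neg A m = neg A c - flat A K"
    "m \<in> cell A (basic (zero A c)) N"
proof -
  obtain m where m: "zero A m = zero A c" "neg A m = neg A c - flat A K"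
    "\<And>i j. i \<in> basic (zero A c) \<Longrightarrow> cut A j i \<Longrightarrow> j \<notin> flat A K"
    using descend[OF A K] by metis
  have "m \<in> cell A (basic (zero A c)) N"
  proof (rule cell_transfer[OF c])
    fix i assume i: "i \<in> basic (zero A c)"
    then have "i \<in> zero A m" using m(1) walls_subset by blast
    then show "n i \<bullet> m = 0" by (simp add: zero_def)
    fix j assume ji: "cut A j i"
    have "zero A c \<subseteq> flat A K" using flat_basic_zero[OF A, of c] flat_mono[OF K(1), of A] by simp
    then show "j \<notin> zero A m \<and> (j \<in> neg A m \<longleftrightarrow> j \<in> neg A c)"
      using m i ji by auto
  qed
  then show ?thesis using that m by blast
qed

lemma exists_rep:
  assumes A: "simplicial A"
  obtains T where "T \<in> sep_sets A" "lower_walls A T = basic (zero A q)" "q \<in> cell A (lower_walls A T) T"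
proof -
  note g = simplicial_good[OF A]
  let ?L = "basic (zero A q)"
  define C where "C = {c. zero A c = zero A q \<and> c \<in> cell A ?L (neg A q)}"
  have cz: "j \<notin> zero A q" if "i \<in> ?L" "cut A j i" for i j
    using basic_uncut[OF that(1), of j] cut_zero[of j A q i] that walls_subset by blast
  have "q \<in> C"
  proof -
    have "signed (neg A q) j \<bullet> q > 0" if "i \<in> ?L" "cut A j i" for i j
      using cz[OF that] cut_in[OF that(2)] unfolding signed_pos_iff by (auto simp: neg_def zero_def)
    moreover have "n i \<bullet> q = 0" if "i \<in> ?L" for i
      using that walls_subset by (force simp: zero_def)
    ultimately show ?thesis by (auto simp: C_def cell_def)
  qed
  \<comment> \<open>A point of the class with fewest hyperplanes between it and the base; a lower
    wall of its top region missing \<open>c\<close> would allow a further descent.\<close>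
  then obtain c where c: "c \<in> C" "\<And>d. d \<in> C \<Longrightarrow> card (neg A c) \<le> card (neg A d)"
    using exists_least_iff[of "\<lambda>k. \<exists>c. c \<in> C \<and> card (neg A c) = k"] by (metis not_less)
  have zc: "zero A c = zero A q" and cc: "c \<in> cell A ?L (neg A q)" using c(1) by (auto simp: C_def)
  let ?T = "neg A c \<union> zero A c"
  have T: "?T \<in> sep_sets A" and bz: "?L = walls A ?T \<inter> zero A q"
    using top_sep_sets[OF A, of c] zc by auto
  have lwT: "lower_walls A ?T = ?L"
  proof (rule ccontr)
    assume ne: "lower_walls A ?T \<noteq> ?L"
    have "?L \<subseteq> lower_walls A ?T" using bz zc by auto
    then obtain W where W: "W \<in> lower_walls A ?T" "W \<notin> ?L" using ne by blast
    then have Wn: "W \<in> neg A c" using bz zc by auto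
    have K: "basic (zero A c) \<subseteq> lower_walls A ?T" using bz zc by auto
    have "c \<in> cell A (basic (zero A c)) (neg A q)" using cc zc by simp
    then obtain m where m: "zero A m = zero A c" "neg A m = neg A c - flat A (lower_walls A ?T)"
      "m \<in> cell A (basic (zero A c)) (neg A q)"
      using descend_cell[OF A K] by blast
    have "W \<in> flat A (lower_walls A ?T)" using W(1) flat_base[of "lower_walls A ?T" A] walls_subset[of A ?T] by blast
    then have "neg A m \<subset> neg A c" using m(2) Wn by blast
    then have "card (neg A m) < card (neg A c)"
      using psubset_card_mono finite_subset[OF _ positive_finite[OF g]] by (metis (no_types, lifting) sep_sets_subset T Un_subset_iff)
    moreover have "m \<in> C" using m zc by (auto simp: C_def)
    ultimately show False using c(2) by fastforce
  qed
  have "q \<in> cell A ?L ?T"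
  proof -
    have "signed ?T j \<bullet> q > 0" if ij: "i \<in> ?L" "cut A j i" for i j
    proof -
      have "signed (neg A q) j \<bullet> c > 0" using cc ij by (auto simp: cell_def)
      then show ?thesis using cz[OF ij] zc cut_in[OF ij(2)]
        unfolding signed_pos_iff by (auto simp: neg_def zero_def split: if_splits)
    qed
    then show ?thesis using \<open>q \<in> C\<close> by (auto simp: C_def cell_def)
  qed
  then show ?thesis using that[OF T lwT] lwT by simp
qed

text \<open>If \<open>d\<close> satisfied all wall inequalities of the top region of
  \<open>c\<close>, then \<open>neg A c\<close> would be contained in \<open>neg A d\<close>. So a
  wall \<open>W\<close> off \<open>c\<close> fails at \<open>d\<close>, and it is a lower wall. The
  localization at \<open>W\<close> and the basic hyperplanes of \<open>c\<close> has normals that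
  are, up to one common sign, nonnegative combinations of theirs, so none of them is negative at
  \<open>d\<close>.\<close>

lemma lower_bound_step:
  assumes A: "simplicial A" and cd: "zero A d = zero A c" "neg A d \<subset> neg A c"
  obtains W where "W \<in> lower_walls A (neg A c \<union> zero A c)" "W \<notin> zero A c"
    "\<And>j. j \<in> flat A (insert W (basic (zero A c))) \<Longrightarrow> j \<notin> neg A d"
proof -
  note g = simplicial_good[OF A]
  let ?T = "neg A c \<union> zero A c" let ?L = "basic (zero A c)"
  have T: "?T \<in> sep_sets A" and bz: "?L = walls A ?T \<inter> zero A c"
    using top_sep_sets[OF A, of c] by auto
  have "\<exists>W\<in>walls A ?T. W \<notin> zero A c \<and> \<not> signed ?T W \<bullet> d > 0"
  proof (rule ccontr)
    assume neg: "\<not> ?thesis"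
    have W: "signed ?T W \<bullet> d \<ge> 0" if "W \<in> walls A ?T" for W
    proof (cases "W \<in> zero A c")
      case True
      then have "n W \<bullet> d = 0" using cd(1) by (auto simp: zero_def)
      then show ?thesis by (simp add: signed_def)
    next
      case False
      then show ?thesis using that neg by (metis less_imp_le)
    qed
    have "signed ?T i \<bullet> d \<ge> 0" if i: "i \<in> A" for i
    proof -
      obtain a where "\<And>w. a w \<ge> (0::real)" "signed ?T i = (\<Sum>w\<in>walls A ?T. a w *\<^sub>R signed ?T w)"
        using wall_coeffs[OF A T i] by blast
      then show ?thesis using W by (simp add: inner_sum_left sum_nonneg)
    qed
    then have "signed ?T i \<bullet> d > 0" if "i \<in> neg A c" for i
      using that cd(1) neg_zero_disjoint[of A c]
      by (smt (verit) IntI emptyE mem_Collect_eq neg_def signed_zero_iff zero_def)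
    then have "neg A c \<subseteq> neg A d" unfolding signed_pos_iff by (auto simp: neg_def)
    then show False using cd by blast
  qed
  then obtain W where W: "W \<in> walls A ?T" "W \<notin> zero A c" "\<not> signed ?T W \<bullet> d > 0" by blast
  have WA: "W \<in> A" using W walls_subset by blast
  have Wd: "W \<notin> zero A d" using W cd by blast
  have Wn: "W \<in> neg A c"
  proof (rule ccontr)
    assume "W \<notin> neg A c"
    then have "W \<notin> ?T" "W \<notin> neg A d" using W(2) cd by auto
    then show False using W(3) WA Wd unfolding signed_pos_iff by (auto simp: neg_def zero_def)
  qed
  have Wpos: "n W \<bullet> d > 0"
    using W(3) Wn Wd WA unfolding signed_pos_iff by (auto simp: zero_def)
  have K: "insert W ?L \<subseteq> lower_walls A ?T" using W Wn bz by auto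
  have "j \<notin> neg A d" if j: "j \<in> flat A (insert W ?L)" for j
  proof -
    have jT: "j \<in> ?T" using basic_flat[OF A T K] j by blast
    have "insert W ?L \<subseteq> walls A ?T" using K by blast
    from face_coeffs[OF A T this]
    have "\<exists>a. (\<forall>k. a k \<ge> (0::real)) \<and> signed ?T j = (\<Sum>k\<in>insert W ?L. a k *\<^sub>R signed ?T k)"
      using j by blast
    then obtain a where a: "\<forall>k. a k \<ge> (0::real)" "signed ?T j = (\<Sum>k\<in>insert W ?L. a k *\<^sub>R signed ?T k)"
      by blast
    have "signed ?T k \<bullet> d \<le> 0" if "k \<in> insert W ?L" for k
    proof (cases "k = W")
      case True
      then show ?thesis using Wpos Wn by (simp add: signed_def)
    next
      case False
      then have "k \<in> zero A d" using that bz cd by auto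
      then show ?thesis by (simp add: zero_def signed_def)
    qed
    then have "signed ?T j \<bullet> d \<le> 0"
      unfolding a(2) inner_sum_left using a(1) by (intro sum_nonpos) (simp add: mult_nonneg_nonpos)
    then show ?thesis using jT by (auto simp: signed_def neg_def)
  qed
  then show ?thesis using that[of W] K W by auto
qed

text \<open>Newman's argument: the descents from \<open>c\<close> across two lower walls \<open>W\<close> and \<open>V\<close> meet again on the
  opposite side of \<open>W \<inter> V\<close>.\<close>

lemma minimum_below:
  assumes A: "simplicial A" and L: "L = basic (zero A p)" and lwp: "lower_walls A (neg A p \<union> zero A p) = L"
    and c: "zero A c = zero A p" "c \<in> cell A L N" and d: "zero A d = zero A p" "neg A d \<subseteq> neg A c"
    and pc: "neg A p \<subseteq> neg A c"
  shows "neg A p \<subseteq> neg A d"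
  using c d pc
proof (induction "card (neg A c)" arbitrary: c d rule: less_induct)
  case less
  note g = simplicial_good[OF A]
  let ?T = "neg A c \<union> zero A c"
  have fin: "finite (neg A x)" for x using finite_subset[OF _ positive_finite[OF g]] by (auto simp: neg_def)
  have T: "?T \<in> sep_sets A" and bz: "L = walls A ?T \<inter> zero A c"
    using top_sep_sets[OF A, of c] less.prems L by auto
  have Lc: "L = basic (zero A c)" using L less.prems by simp
  show ?case
  proof (cases "neg A d = neg A c")
    case True
    then show ?thesis using less.prems by simp
  next
    case False
    then have dc: "neg A d \<subset> neg A c" using less.prems by blast
    obtain W where W: "W \<in> lower_walls A ?T" "W \<notin> zero A c"
      "\<And>j. j \<in> flat A (insert W L) \<Longrightarrow> j \<notin> neg A d"
      using lower_bound_step[OF A _ dc] less.prems Lc by metis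
    \<comment> \<open>The top region of \<open>c\<close> has the lower wall \<open>W\<close> off
      \<open>c\<close>, whereas the lower walls of the top region of \<open>p\<close> all belong to
      \<open>L\<close>.\<close>
    have "neg A p \<noteq> neg A c"
      using W lwp less.prems L bz by (metis Int_iff)
    then have pc: "neg A p \<subset> neg A c" using less.prems by blast
    obtain V where V: "V \<in> lower_walls A ?T" "V \<notin> zero A c"
      "\<And>j. j \<in> flat A (insert V L) \<Longrightarrow> j \<notin> neg A p"
      using lower_bound_step[OF A _ pc] less.prems Lc by metis
    have step: "\<exists>m. zero A m = zero A p \<and> neg A m = neg A c - flat A (U \<union> L) \<and> m \<in> cell A L N"
      if "U \<subseteq> lower_walls A ?T" for U
    proof -
      have K: "basic (zero A c) \<subseteq> U \<union> L" "U \<union> L \<subseteq> lower_walls A ?T" using that bz Lc by auto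
      show ?thesis
        using descend_cell[OF A K] less.prems Lc by metis
    qed
    obtain c1 where c1: "zero A c1 = zero A p" "neg A c1 = neg A c - flat A (insert W L)" "c1 \<in> cell A L N"
      using step[of "{W}"] W(1) by auto
    obtain c2 where c2: "zero A c2 = zero A p" "neg A c2 = neg A c - flat A (insert V L)" "c2 \<in> cell A L N"
      using step[of "{V}"] V(1) by auto
    obtain m where m: "zero A m = zero A p" "neg A m = neg A c - flat A ({V, W} \<union> L)" "m \<in> cell A L N"
      using step[of "{V, W}"] V(1) W(1) by auto
    have inA: "insert W L \<subseteq> A" "insert V L \<subseteq> A" using W V bz walls_subset zero_subset by blast+
    have "W \<in> neg A c - neg A c1" "V \<in> neg A c - neg A c2"
      using W V c1 c2 flat_base[OF inA(1)] flat_base[OF inA(2)] by auto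
    then have lt: "card (neg A c1) < card (neg A c)" "card (neg A c2) < card (neg A c)"
      using c1 c2 by (auto intro!: psubset_card_mono fin)
    have "flat A (insert V L) \<subseteq> flat A ({V, W} \<union> L)" "flat A (insert W L) \<subseteq> flat A ({V, W} \<union> L)"
      by (rule flat_mono; auto)+
    then have m12: "neg A m \<subseteq> neg A c1" "neg A m \<subseteq> neg A c2" using m c1 c2 by auto
    \<comment> \<open>The induction is used twice: from \<open>c2\<close> with \<open>m\<close> as
      target it places \<open>p\<close> below \<open>m\<close>, hence below \<open>c1\<close>; from
      \<open>c1\<close> it then reaches \<open>d\<close>.\<close>
    have "neg A p \<subseteq> neg A c2" using V(3) pc c2 by auto
    then have "neg A p \<subseteq> neg A m"
      using less.hyps[OF lt(2) c2(1,3) m(1) m12(2)] by blast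
    moreover have "neg A d \<subseteq> neg A c1" using W(3) less.prems c1 by auto
    ultimately show ?thesis
      using less.hyps[OF lt(1) c1(1,3), of d] less.prems m12 by blast
  qed
qed

text \<open>A point of the cell may lie on hyperplanes not containing \<open>p\<close>. None of them
  cuts a member of \<open>L\<close>, so \<open>L\<close> stays basic in the localization at
  \<open>z\<close>, and \<open>z\<close> can be pushed off the extra hyperplanes to their positive
  side.\<close>

lemma generic_below:
  assumes A: "simplicial A" and L: "L = basic (zero A p)" and z: "z \<in> cell A L N"
  obtains m where "zero A m = zero A p" "neg A m = neg A z" "m \<in> cell A L N"
proof -
  note g = simplicial_good[OF A]
  let ?Z = "zero A z"
  have sZ: "simplicial ?Z" using simplicial_zero[OF A] .
  have Lz: "L \<subseteq> ?Z"
    using z L walls_subset zero_subset by (fastforce simp: cell_def zero_def)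
  have "L \<subseteq> basic ?Z"
  proof
    fix i assume i: "i \<in> L"
    show "i \<in> basic ?Z"
    proof (rule uncut_basic[OF sZ])
      show "i \<in> ?Z" using i Lz by blast
      fix j show "\<not> cut ?Z j i"
      proof
        assume c: "cut ?Z j i"
        then have jz: "j \<in> ?Z" by (simp add: cut_def)
        then have "cut A j i" using c cut_zero i Lz by blast
        then have "signed N j \<bullet> z > 0" using z i by (auto simp: cell_def)
        then show False using jz by (auto simp: zero_def signed_def split: if_splits)
      qed
    qed
  qed
  have zp: "zero A p \<subseteq> ?Z"
  proof
    fix i assume "i \<in> zero A p"
    then have "i \<in> flat A L" using flat_basic_zero[OF A, of p] L by simp
    then have "i \<in> A" "n i \<bullet> z = 0" using flat_orth[of i A L z] z flat_subset by (auto simp: cell_def)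
    then show "i \<in> ?Z" by (simp add: zero_def)
  qed
  then have "zero ?Z p = zero A p" using zero_zero[OF zero_subset, of A z p] by auto
  then obtain y where y: "zero ?Z y = zero A p" "neg ?Z y = {}"
    using positive_point[OF sZ, of p] \<open>L \<subseteq> basic ?Z\<close> L by metis
  obtain m where "zero A m = zero A z \<inter> zero A y" "neg A m = neg A z \<union> (zero A z \<inter> neg A y)"
    using compose[OF positive_finite[OF g]] .
  then have m: "zero A m = zero A p" "neg A m = neg A z"
    using y zero_zero[OF zero_subset, of A z y] neg_neg[OF zero_subset, of A z y] by auto
  have "m \<in> cell A L N"
  proof (rule cell_transfer[OF z])
    fix i assume i: "i \<in> L"
    then have "i \<in> zero A m" using m(1) L walls_subset by blast
    then show "n i \<bullet> m = 0" by (simp add: zero_def)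
    fix j assume ji: "cut A j i"
    then have "signed N j \<bullet> z > 0" using z i by (auto simp: cell_def)
    then have "j \<notin> zero A z" by (auto simp: zero_def signed_def split: if_splits)
    then show "j \<notin> zero A m \<and> (j \<in> neg A m \<longleftrightarrow> j \<in> neg A z)"
      using m zp by auto
  qed
  then show ?thesis using that m by blast
qed

lemma convex_cell: "convex (cell A L N)"
proof -
  have "cell A L N = (\<Inter>i\<in>L. {z. n i \<bullet> z = 0}) \<inter> (\<Inter>i\<in>L. \<Inter>j\<in>{j. cut A j i}. {z. signed N j \<bullet> z > 0})"
    by (auto simp: cell_def)
  then show ?thesis
    by (auto intro!: convex_Int convex_INT convex_hyperplane convex_halfspace_gt)
qed

text \<open>Near a point \<open>u\<close> the negative set can only grow, and for nested negative
  sets \<open>mono\<close> shows that lying above \<open>p\<close> passes down as well as up. So the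
  property of lying above \<open>p\<close> is locally constant on the convex cell.\<close>

lemma minimum_cell:
  assumes A: "simplicial A" and L: "L = basic (zero A p)" and lwp: "lower_walls A (neg A p \<union> zero A p) = L"
    and p: "p \<in> cell A L N" and z: "z \<in> cell A L N"
  shows "neg A p \<subseteq> neg A z"
proof -
  note g = simplicial_good[OF A]
  have mono: "neg A p \<subseteq> neg A u" if u: "u \<in> cell A L N" and v: "v \<in> cell A L N"
    and uv: "neg A u \<subseteq> neg A v" and pv: "neg A p \<subseteq> neg A v" for u v
  proof -
    obtain u' where u': "zero A u' = zero A p" "neg A u' = neg A u"
      using generic_below[OF A L u] by metis
    obtain v' where v': "zero A v' = zero A p" "neg A v' = neg A v" "v' \<in> cell A L N"
      using generic_below[OF A L v] by metis
    show ?thesis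
      using minimum_below[OF A L lwp v'(1,3) u'(1)] u'(2) v'(2) uv pv by simp
  qed
  have near: "\<forall>\<^sub>F v in at u within cell A L N. neg A u \<subseteq> neg A v" for u
  proof -
    have "\<forall>\<^sub>F v in at u within cell A L N. \<forall>i\<in>neg A u. n i \<bullet> v < 0"
    proof (rule eventually_ball_finite, goal_cases)
      case 1
      then show ?case using finite_subset[OF _ positive_finite[OF g]] by (auto simp: neg_def)
    next
      case 2
      have "((\<lambda>v. n i \<bullet> v) \<longlongrightarrow> n i \<bullet> u) (at u within cell A L N)" for i
        by (intro tendsto_intros)
      then show ?case using order_tendstoD(2) by (fastforce simp: neg_def)
    qed
    then show ?thesis by (rule eventually_mono) (auto simp: neg_def)
  qed
  have "(neg A p \<subseteq> neg A p) = (neg A p \<subseteq> neg A z)"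
  proof (rule connected_local_const[OF convex_connected[OF convex_cell] p z], rule ballI)
    fix u assume u: "u \<in> cell A L N"
    have "\<forall>\<^sub>F v in at u within cell A L N. v \<in> cell A L N"
      by (simp add: eventually_at_filter)
    with near[of u] show "\<forall>\<^sub>F v in at u within cell A L N. (neg A p \<subseteq> neg A u) = (neg A p \<subseteq> neg A v)"
      by eventually_elim (use mono u in blast)
  qed
  then show ?thesis by simp
qed

text \<open>A generic point of the lower face of \<open>T\<close>. The lower walls are basic in its
  localization, so their cutters miss \<open>p\<close> and have there the strict signs prescribed by
  \<open>T\<close>.\<close>

lemma face_point:
  assumes A: "simplicial A" and T: "T \<in> sep_sets A"
  obtains p where "zero A p = flat A (lower_walls A T)" "neg A p = T - flat A (lower_walls A T)"
    "basic (zero A p) = lower_walls A T" "zero A p \<subseteq> T" "p \<in> cell A (lower_walls A T) T"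
proof -
  obtain p where p: "zero A p = flat A (lower_walls A T)" "neg A p = T - flat A (lower_walls A T)"
    using face[OF A T, of "lower_walls A T"] by auto
  have b: "basic (zero A p) = lower_walls A T" "zero A p \<subseteq> T"
    using basic_flat[OF A T, of "lower_walls A T"] p by auto
  have "signed T j \<bullet> p > 0" if "i \<in> lower_walls A T" "cut A j i" for i j
  proof -
    have "j \<notin> zero A p"
      using basic_uncut[of i "zero A p" j] cut_zero[of j A p i] that walls_subset b by blast
    then show ?thesis using p(1,2) cut_in[OF that(2)]
      unfolding signed_pos_iff by (auto simp: neg_def zero_def)
  qed
  moreover have "n i \<bullet> p = 0" if "i \<in> lower_walls A T" for i
    using that b walls_subset by (force simp: zero_def)
  ultimately have "p \<in> cell A (lower_walls A T) T" by (auto simp: cell_def)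
  then show ?thesis using that p b by blast
qed

text \<open>A common point forces the two cells to coincide, and the lower faces of both regions
  minimize the negative set on it.\<close>

lemma rep_unique:
  assumes A: "simplicial A" and T: "T \<in> sep_sets A" "T' \<in> sep_sets A" and lower_walls: "lower_walls A T = lower_walls A T'"
    and q: "q \<in> cell A (lower_walls A T) T" "q \<in> cell A (lower_walls A T') T'"
  shows "T = T'"
proof -
  let ?L = "lower_walls A T"
  have agree: "j \<in> T \<longleftrightarrow> j \<in> T'" if "i \<in> ?L" "cut A j i" for i j
  proof -
    have "signed T j \<bullet> q > 0" "signed T' j \<bullet> q > 0" using q that lower_walls unfolding cell_def by auto
    then show ?thesis unfolding signed_pos_iff by (auto split: if_splits)
  qed
  have ceq: "cell A ?L T = cell A ?L T'"
  proof -
    have "signed T j = signed T' j" if "i \<in> ?L" "cut A j i" for i j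
      using agree[OF that] by (simp add: signed_def)
    then show ?thesis unfolding cell_def by auto
  qed
  obtain p where p: "zero A p = flat A ?L" "neg A p = T - flat A ?L"
    "basic (zero A p) = ?L" "zero A p \<subseteq> T" "p \<in> cell A ?L T"
    using face_point[OF A T(1)] .
  obtain p' where p': "zero A p' = flat A ?L" "neg A p' = T' - flat A ?L"
    "basic (zero A p') = ?L" "zero A p' \<subseteq> T'" "p' \<in> cell A ?L T'"
    using face_point[OF A T(2)] lower_walls by metis
  have e: "neg A p \<union> zero A p = T" "neg A p' \<union> zero A p' = T'" using p p' by auto
  have "neg A p \<subseteq> neg A p'"
    by (rule minimum_cell[OF A p(3)[symmetric] _ p(5)]) (use e p' ceq in auto)
  moreover have "neg A p' \<subseteq> neg A p"
    by (rule minimum_cell[OF A p'(3)[symmetric] _ p'(5)]) (use e p ceq lower_walls in auto)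
  ultimately show ?thesis using e p p' by auto
qed

section \<open>Lower intervals\<close>

text \<open>The set \<open>\<psi>(T)\<close>, the closed counterpart of \<open>cell\<close>: each
  lower wall contributes the equation and the inequalities of one shard.\<close>

definition cone :: "'i set \<Rightarrow> 'i set \<Rightarrow> 'a set" where
  "cone A T = {x. (\<forall>i\<in>lower_walls A T. n i \<bullet> x = 0) \<and> (\<forall>i\<in>lower_walls A T. \<forall>j. cut A j i \<longrightarrow> signed T j \<bullet> x \<ge> 0)}"

lemma cell_cone: "x \<in> cell A (lower_walls A T) T \<Longrightarrow> x \<in> cone A T"
  by (auto simp: cell_def cone_def less_imp_le)

lemma flat_idem: "flat A K \<subseteq> flat A K' \<longleftrightarrow> K \<subseteq> flat A K'" if "K \<subseteq> A"
proof
  show "flat A K \<subseteq> flat A K' \<Longrightarrow> K \<subseteq> flat A K'" using flat_base[OF that] by blast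
  assume K: "K \<subseteq> flat A K'"
  then have "n ` K \<subseteq> span (n ` K')" by (auto simp: flat_def)
  then have "span (n ` K) \<subseteq> span (n ` K')" by (simp add: span_minimal)
  then show "flat A K \<subseteq> flat A K'" by (auto simp: flat_def)
qed

text \<open>Comparison of cones is tested at the single point \<open>p\<close>. A violated
  inequality would produce a point on the segment from \<open>p\<close> to \<open>x\<close> at which
  \<open>i\<close> turns out to be basic in the rank-two localization with its cutter
  \<open>j\<close>.\<close>

lemma cone_mono:
  assumes A: "simplicial A" and p: "zero A p = flat A (lower_walls A R)" "basic (zero A p) = lower_walls A R"
    "p \<in> cell A (lower_walls A R) R" and pQ: "p \<in> cone A Q"
  shows "cone A R \<subseteq> cone A Q"
proof
  fix x assume x: "x \<in> cone A R"
  note g = simplicial_good[OF A]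
  have lwQ: "lower_walls A Q \<subseteq> zero A p"
    using pQ walls_subset by (fastforce simp: cone_def zero_def)
  have x0: "n i \<bullet> x = 0" if "i \<in> zero A p" for i
    using flat_orth[of i A "lower_walls A R" x] that x p(1) by (auto simp: cone_def)
  have "signed Q j \<bullet> x \<ge> 0" if i: "i \<in> lower_walls A Q" and ji: "cut A j i" for i j
  proof (rule ccontr)
    assume neg: "\<not> signed Q j \<bullet> x \<ge> 0"
    have jA: "j \<in> A" using ji by (simp add: cut_def)
    have iz: "i \<in> zero A p" using lwQ i by blast
    have jz: "j \<notin> zero A p" using neg x0[of j] by (auto simp: signed_def split: if_splits)
    have jp: "signed Q j \<bullet> p > 0"
    proof -
      have "signed Q j \<bullet> p \<ge> 0" using pQ i ji by (auto simp: cone_def)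
      moreover have "signed Q j \<bullet> p \<noteq> 0" using jz jA by (auto simp: zero_def signed_zero_iff)
      ultimately show ?thesis by simp
    qed
    define s where "s = - (signed Q j \<bullet> x)"
    define t where "t = signed Q j \<bullet> p"
    have st: "s > 0" "t > 0" using neg jp by (auto simp: s_def t_def)
    \<comment> \<open>The weights place \<open>z\<close>, up to scaling, where \<open>j\<close>
      vanishes on the segment. Cutters of lower walls of \<open>R\<close> are strict at
      \<open>p\<close> and weak at \<open>x\<close>, hence miss \<open>z\<close>.\<close>
    define z where "z = s *\<^sub>R p + t *\<^sub>R x"
    have "signed Q j \<bullet> z = 0" by (simp add: z_def inner_add_right inner_diff_right s_def t_def)
    then have jZ: "j \<in> zero A z" using jA by (simp add: zero_def signed_zero_iff)
    have pz: "zero A p \<subseteq> zero A z"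
      using x0 by (auto simp: zero_def z_def inner_add_right)
    have "lower_walls A R \<subseteq> basic (zero A z)"
    proof
      fix l assume l: "l \<in> lower_walls A R"
      have lz: "l \<in> zero A z" using l p(2) walls_subset pz by blast
      show "l \<in> basic (zero A z)"
      proof (rule uncut_basic[OF simplicial_zero[OF A] lz])
        fix k show "\<not> cut (zero A z) k l"
        proof
          assume c: "cut (zero A z) k l"
          then have kz: "k \<in> zero A z" by (simp add: cut_def)
          then have "cut A k l" using c cut_zero lz by blast
          then have "signed R k \<bullet> p > 0" "signed R k \<bullet> x \<ge> 0"
            using p(3) x l by (auto simp: cell_def cone_def)
          then have "signed R k \<bullet> z > 0"
            using st by (simp add: z_def inner_add_right add_pos_nonneg)
          then show False using kz by (auto simp: zero_def signed_def split: if_splits)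
        qed
      qed
    qed
    moreover have zzp: "zero (zero A z) p = zero A p"
      using zero_zero[OF zero_subset, of A z p] pz by auto
    ultimately obtain y where y: "zero (zero A z) y = zero A p" "neg (zero A z) y = {}"
      using positive_point[OF simplicial_zero[OF A], of z p] p(2) by metis
    have iZ: "i \<in> zero A z" using iz pz by blast
    have fl: "flat A {j, i} = flat (zero A z) {j, i}"
      using flat_zero_pair[OF jZ iZ] by simp
    have yj: "n j \<bullet> y \<noteq> 0" using y(1) jZ jz by (auto simp: zero_def)
    have yi: "n i \<bullet> y = 0" using y(1) iz by (auto simp: zero_def)
    \<comment> \<open>Within the rank-two localization \<open>y\<close> lies on \<open>i\<close>
      alone and is negative nowhere, which exhibits \<open>i\<close> as basic, contrary to
      \<open>cut A j i\<close>.\<close>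
    have "zero (flat A {j, i}) y = {i}"
    proof (intro equalityI subsetI)
      fix k assume "k \<in> zero (flat A {j, i}) y"
      then have k: "k \<in> A" "n k \<in> span {n j, n i}" "n k \<bullet> y = 0"
        by (auto simp: zero_def flat_def)
      then obtain a c where "n k = a *\<^sub>R n j + c *\<^sub>R n i"
        using span_breakdown[of "n j" "{n j, n i}" "n k"]
        by (auto simp: span_insert span_singleton algebra_simps)
      then have "n k \<in> span {n i}"
        using k(3) yi yj by (auto simp: inner_add_left span_base span_scale)
      then show "k \<in> {i}" using flat_singleton[OF g, of i] k(1) iz zero_subset by (auto simp: flat_def)
    next
      fix k assume "k \<in> {i}"
      then show "k \<in> zero (flat A {j, i}) y"
        using yi flat_base[of "{j,i}" A] jA iz zero_subset by (auto simp: zero_def)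
    qed
    moreover have "neg (flat A {j, i}) y = {}"
      using y(2) fl flat_subset[of "zero A z" "{j,i}"] by (auto simp: neg_def)
    ultimately have "i \<in> basic (flat A {j, i})"
      using walls_iff[of "{}" "flat A {j, i}" i] by auto
    then show False using ji by (simp add: cut_def)
  qed
  then show "x \<in> cone A Q" using x0 lwQ by (auto simp: cone_def)
qed

text \<open>The lower face points lie in each other's cones, so the flats and the lower walls agree.
  The weak inequalities of \<open>Q\<close> are strict at \<open>p\<close> because \<open>p\<close>
  is off all cutters, and \<open>rep_unique\<close> applies.\<close>

lemma cone_antisym:
  assumes A: "simplicial A" and QR: "Q \<in> sep_sets A" "R \<in> sep_sets A" and eq: "cone A Q = cone A R"
  shows "Q = R"
proof -
  obtain p where p: "zero A p = flat A (lower_walls A R)" "neg A p = R - flat A (lower_walls A R)"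
    "basic (zero A p) = lower_walls A R" "zero A p \<subseteq> R" "p \<in> cell A (lower_walls A R) R"
    using face_point[OF A QR(2)] .
  obtain q where q: "zero A q = flat A (lower_walls A Q)" "neg A q = Q - flat A (lower_walls A Q)"
    "basic (zero A q) = lower_walls A Q" "zero A q \<subseteq> Q" "q \<in> cell A (lower_walls A Q) Q"
    using face_point[OF A QR(1)] .
  have pQ: "p \<in> cone A Q" "q \<in> cone A R" using cell_cone[OF p(5)] cell_cone[OF q(5)] eq by auto
  have sub: "lower_walls A Q \<subseteq> A" "lower_walls A R \<subseteq> A" using walls_subset by blast+
  have "lower_walls A Q \<subseteq> flat A (lower_walls A R)" using pQ(1) sub p(1) by (fastforce simp: cone_def zero_def)
  moreover have "lower_walls A R \<subseteq> flat A (lower_walls A Q)" using pQ(2) sub q(1) by (fastforce simp: cone_def zero_def)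
  ultimately have "flat A (lower_walls A R) = flat A (lower_walls A Q)" using flat_idem sub by blast
  then have lower_walls: "lower_walls A R = lower_walls A Q" using p q by metis
  have "p \<in> cell A (lower_walls A Q) Q"
  proof -
    have "signed Q j \<bullet> p > 0" if "i \<in> lower_walls A Q" "cut A j i" for i j
    proof -
      have "signed R j \<bullet> p > 0" using p(5) lower_walls that by (auto simp: cell_def)
      then have "signed Q j \<bullet> p \<noteq> 0" by (auto simp: signed_def split: if_splits)
      moreover have "signed Q j \<bullet> p \<ge> 0" using pQ(1) that by (auto simp: cone_def)
      ultimately show ?thesis by simp
    qed
    then show ?thesis using pQ(1) by (auto simp: cone_def cell_def)
  qed
  then show ?thesis using rep_unique[OF A QR(2,1) lower_walls p(5)] by simp
qed

text \<open>Both sides are parametrized by classes of points: for the lower face \<open>p\<close> of \<open>R\<close>, a class of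
  the localization at \<open>p\<close> meets every neighbourhood of \<open>p\<close>, hence determines a class of \<open>A\<close>.\<close>

lemma lower_interval:
  assumes A: "simplicial A" and R: "R \<in> sep_sets A"
  obtains f where "bij_betw f {Q \<in> sep_sets A. cone A R \<subseteq> cone A Q} (sep_sets (flat A (lower_walls A R)))"
    "\<And>Q. Q \<in> sep_sets A \<Longrightarrow> cone A R \<subseteq> cone A Q \<Longrightarrow>
      lower_walls (flat A (lower_walls A R)) (f Q) = lower_walls A Q \<and> lower_walls A Q \<subseteq> flat A (lower_walls A R)"
proof -
  note g = simplicial_good[OF A]
  let ?D = "{Q \<in> sep_sets A. cone A R \<subseteq> cone A Q}"
  obtain p where p: "zero A p = flat A (lower_walls A R)" "neg A p = R - flat A (lower_walls A R)"
    "basic (zero A p) = lower_walls A R" "zero A p \<subseteq> R" "p \<in> cell A (lower_walls A R) R"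
    using face_point[OF A R] .
  define Z where "Z = zero A p"
  have Zf: "Z = flat A (lower_walls A R)" using p Z_def by simp
  have ZA: "Z \<subseteq> A" using zero_subset Z_def by simp
  have sZ: "simplicial Z" using simplicial_zero[OF A] Z_def by simp
  have D_iff: "Q \<in> ?D \<longleftrightarrow> Q \<in> sep_sets A \<and> p \<in> cone A Q" for Q
    using cone_mono[OF A p(1,3,5), of Q] cell_cone[OF p(5)] by blast
  have lwZ: "lower_walls A Q \<subseteq> Z" if "p \<in> cone A Q" for Q
    using that walls_subset by (fastforce simp: cone_def zero_def Z_def)
  have cutZ: "cut Z j i \<longleftrightarrow> cut A j i" if "i \<in> Z" "j \<in> Z" for i j
    using cut_zero[of j A p i] that Z_def by simp
  have zeroZ: "zero A q = zero Z q" if "zero A q \<subseteq> Z" for q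
    using zero_zero[OF ZA] that by auto
  \<comment> \<open>Regions \<open>Q\<close> of \<open>A\<close> and \<open>T\<close> of the
    localization correspond when they have the same lower walls and their cells share a point
    \<open>q\<close>.\<close>
  define P where "P Q T q \<longleftrightarrow> T \<in> sep_sets Z \<and> lower_walls Z T = lower_walls A Q \<and>
      q \<in> cell Z (lower_walls Z T) T \<and> q \<in> cell A (lower_walls A Q) Q" for Q T q
  have ex: "\<exists>r. P Q (fst r) (snd r)" if Q: "Q \<in> ?D" for Q
  proof -
    have QR: "Q \<in> sep_sets A" using Q by simp
    obtain q where q: "zero A q = flat A (lower_walls A Q)" "neg A q = Q - flat A (lower_walls A Q)"
      "basic (zero A q) = lower_walls A Q" "q \<in> cell A (lower_walls A Q) Q"
      using face_point[OF A QR] by metis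
    have sub: "lower_walls A Q \<subseteq> A" using walls_subset by blast
    have "lower_walls A Q \<subseteq> Z" using lwZ Q D_iff by blast
    then have "zero A q \<subseteq> Z" using q(1) flat_idem[OF sub] Zf by simp
    then have zq: "basic (zero Z q) = lower_walls A Q" using zeroZ q by simp
    obtain T where "T \<in> sep_sets Z" "lower_walls Z T = basic (zero Z q)" "q \<in> cell Z (lower_walls Z T) T"
      using exists_rep[OF sZ] by metis
    then have "P Q T q" using q zq by (simp add: P_def)
    then show ?thesis by (metis fst_conv snd_conv)
  qed
  then have "\<forall>Q\<in>?D. \<exists>r. P Q (fst r) (snd r)" by blast
  from bchoice[OF this] obtain h where h: "\<forall>Q\<in>?D. P Q (fst (h Q)) (snd (h Q))" by blast
  define f where "f Q = fst (h Q)" for Q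
  define qf where "qf Q = snd (h Q)" for Q
  have f: "f Q \<in> sep_sets Z \<and> lower_walls Z (f Q) = lower_walls A Q \<and>
      qf Q \<in> cell Z (lower_walls Z (f Q)) (f Q) \<and> qf Q \<in> cell A (lower_walls A Q) Q" if "Q \<in> ?D" for Q
    using bspec[OF h that] unfolding P_def f_def qf_def by blast
  have inj: "inj_on f ?D"
  proof (rule inj_onI)
    fix Q Q' assume Q: "Q \<in> ?D" and Q': "Q' \<in> ?D" and eq: "f Q = f Q'"
    have lower_walls: "lower_walls A Q = lower_walls A Q'" using f[OF Q] f[OF Q'] eq by metis
    have pos: "signed X j \<bullet> p > 0" if "X \<in> ?D" "i \<in> lower_walls A X" "cut A j i" "j \<notin> Z" for X i j
    proof -
      have "signed X j \<bullet> p \<ge> 0" using D_iff[of X] that(1-3) unfolding cone_def by blast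
      moreover have "signed X j \<bullet> p \<noteq> 0" using that cut_in by (auto simp: Z_def zero_def signed_zero_iff)
      ultimately show ?thesis by simp
    qed
    \<comment> \<open>The signs of the cutters of \<open>Q\<close> can be recovered: those through
      \<open>p\<close> are fixed by \<open>f Q\<close>, those off \<open>p\<close> by the sign at
      \<open>p\<close>, which is strict and prescribed by the cone condition.\<close>
    have "signed Q' j \<bullet> qf Q > 0" if i: "i \<in> lower_walls A Q" and ji: "cut A j i" for i j
    proof -
      have iZ: "i \<in> Z" using lwZ Q D_iff i by blast
      have a: "signed Q j \<bullet> qf Q > 0" using f[OF Q] i ji by (auto simp: cell_def)
      have "j \<in> Q \<longleftrightarrow> j \<in> Q'"
      proof (cases "j \<in> Z")
        case True
        then have c: "cut Z j i" using cutZ iZ ji by blast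
        have "signed (f Q) j \<bullet> qf Q > 0" "signed (f Q) j \<bullet> qf Q' > 0" "signed Q' j \<bullet> qf Q' > 0"
          using f[OF Q] f[OF Q'] i c eq lower_walls ji unfolding cell_def by auto
        then show ?thesis using a unfolding signed_pos_iff by (auto split: if_splits)
      next
        case False
        then have "signed Q j \<bullet> p > 0" "signed Q' j \<bullet> p > 0"
          using pos[OF Q i ji] pos[OF Q' _ ji] i lower_walls by blast+
        then show ?thesis unfolding signed_pos_iff by (auto split: if_splits)
      qed
      then show ?thesis using a by (simp add: signed_def)
    qed
    then have "qf Q \<in> cell A (lower_walls A Q') Q'" using f[OF Q] lower_walls unfolding cell_def by auto
    then show "Q = Q'" using rep_unique[OF A _ _ lower_walls, of "qf Q"] f[OF Q] Q Q' by blast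
  qed
  have surj: "\<exists>Q\<in>?D. f Q = T" if T: "T \<in> sep_sets Z" for T
  proof -
    obtain t where t: "zero Z t = flat Z (lower_walls Z T)" "neg Z t = T - flat Z (lower_walls Z T)"
      "basic (zero Z t) = lower_walls Z T" "t \<in> cell Z (lower_walls Z T) T"
      using face_point[OF sZ T] by metis
    \<comment> \<open>A point near \<open>p\<close> in the direction of the lower face of
      \<open>T\<close>; its class in \<open>A\<close> yields the preimage of
      \<open>T\<close>.\<close>
    obtain q where "zero A q = zero A p \<inter> zero A t" "neg A q = neg A p \<union> (zero A p \<inter> neg A t)"
      using compose[OF positive_finite[OF g]] .
    then have q: "zero A q = zero Z t" "neg A q = neg A p \<union> neg Z t"
      using zero_zero[OF ZA] neg_neg[OF ZA] by (auto simp: Z_def)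
    obtain Q where Q: "Q \<in> sep_sets A" "lower_walls A Q = basic (zero A q)" "q \<in> cell A (lower_walls A Q) Q"
      using exists_rep[OF A] by metis
    have lower_walls: "lower_walls A Q = lower_walls Z T" using Q q t by simp
    have lQ: "lower_walls A Q \<subseteq> Z" using lower_walls walls_subset by blast
    have nz: "j \<notin> zero A q" if "i \<in> lower_walls A Q" "cut A j i" for i j
    proof -
      have "signed Q j \<bullet> q > 0" using Q(3) that by (auto simp: cell_def)
      then show ?thesis by (auto simp: zero_def signed_def split: if_splits)
    qed
    have Qq: "j \<in> Q \<longleftrightarrow> j \<in> neg A q" if "i \<in> lower_walls A Q" "cut A j i" for i j
    proof -
      have "signed Q j \<bullet> q > 0" using Q(3) that by (auto simp: cell_def)
      then show ?thesis using cut_in[OF that(2)] unfolding signed_pos_iff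
        by (auto simp: neg_def split: if_splits)
    qed
    have "p \<in> cone A Q"
    proof -
      have "n i \<bullet> p = 0" if "i \<in> lower_walls A Q" for i using lQ that by (auto simp: Z_def zero_def)
      moreover have "signed Q j \<bullet> p \<ge> 0" if "i \<in> lower_walls A Q" "cut A j i" for i j
      proof (cases "j \<in> Z")
        case True
        then show ?thesis by (auto simp: Z_def zero_def signed_def)
      next
        case False
        then have "j \<in> Q \<longleftrightarrow> j \<in> neg A p" using Qq[OF that] q(2) by (auto simp: neg_def)
        then show ?thesis using cut_in[OF that(2)] by (auto simp: signed_def neg_def)
      qed
      ultimately show ?thesis by (auto simp: cone_def)
    qed
    then have QD: "Q \<in> ?D" using D_iff Q(1) by blast
    \<comment> \<open>The point chosen for \<open>Q\<close> need not be \<open>q\<close>, but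
      cutters inside \<open>Z\<close> have on the cell of \<open>Q\<close> the signs of
      \<open>q\<close>, which are those of \<open>T\<close>.\<close>
    have "qf Q \<in> cell Z (lower_walls Z T) T"
    proof -
      have "signed T j \<bullet> qf Q > 0" if i: "i \<in> lower_walls Z T" and c: "cut Z j i" for i j
      proof -
        have jZ: "j \<in> Z" using c by (simp add: cut_def)
        have ji: "cut A j i" using c cutZ jZ i walls_subset by blast
        have "signed Q j \<bullet> qf Q > 0" using f[OF QD] ji i lower_walls by (auto simp: cell_def)
        moreover have "j \<in> Q \<longleftrightarrow> j \<in> T"
        proof -
          have "j \<notin> zero A q" "j \<in> Q \<longleftrightarrow> j \<in> neg A q" using nz Qq ji i lower_walls by blast+
          moreover have "j \<notin> neg A p" using jZ Z_def neg_zero_disjoint by blast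
          ultimately show ?thesis using q t jZ by auto
        qed
        ultimately show ?thesis by (simp add: signed_def)
      qed
      moreover have "n i \<bullet> qf Q = 0" if "i \<in> lower_walls Z T" for i
        using f[OF QD] that lower_walls by (auto simp: cell_def)
      ultimately show ?thesis by (auto simp: cell_def)
    qed
    moreover have "lower_walls Z (f Q) = lower_walls Z T" using f[OF QD] lower_walls by metis
    ultimately have "f Q = T"
      using rep_unique[OF sZ _ T, of "f Q" "qf Q"] f[OF QD] by metis
    then show ?thesis using QD by blast
  qed
  have "bij_betw f ?D (sep_sets Z)"
    unfolding bij_betw_def using inj surj f by blast
  then show ?thesis using that f lwZ D_iff unfolding Zf by blast
qed

section \<open>Counting faces\<close>

definition weight :: "'i set \<Rightarrow> 'i set \<Rightarrow> int" where
  "weight A T = (\<Sum>K\<in>Pow (lower_walls A T). (-1) ^ card K * int (card (sep_sets (flat A K))))"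

text \<open>The wall normals of a region are a basis of the span of all normals, so all regions have
  equally many walls.\<close>

lemma card_walls:
  assumes A: "simplicial A" and S: "S \<in> sep_sets A"
  shows "card (walls A S) = dim (n ` A)"
proof -
  have inj: "inj_on n (walls A S)"
    using positive_inj[OF simplicial_good[OF A]] walls_subset inj_on_subset by blast
  have "n ` A \<subseteq> span (n ` walls A S)"
  proof
    fix v assume "v \<in> n ` A"
    then obtain i where i: "i \<in> A" "v = n i" by blast
    obtain a where "signed S i = (\<Sum>w\<in>walls A S. a w *\<^sub>R signed S w)"
      using wall_coeffs[OF A S i(1)] by metis
    also have "\<dots> \<in> span (n ` walls A S)"
      by (rule span_sum, rule span_scale) (auto simp: signed_def span_base intro: span_neg)
    finally show "v \<in> span (n ` walls A S)"
      using i span_neg[of "- n i"] by (auto simp: signed_def split: if_splits)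
  qed
  then have "card (n ` walls A S) = dim (n ` A)"
    using basis_card_eq_dim[OF _ _ walls_indep[OF A S]] walls_subset by (metis image_mono)
  then show ?thesis by (simp add: card_image[OF inj])
qed

lemma walls_nonempty: "simplicial A \<Longrightarrow> S \<in> sep_sets A \<Longrightarrow> walls A S = {} \<longleftrightarrow> A = {}"
proof
  assume A: "simplicial A" and S: "S \<in> sep_sets A" and e: "walls A S = {}"
  show "A = {}"
  proof (rule ccontr)
    assume "A \<noteq> {}"
    then obtain i where i: "i \<in> A" by blast
    obtain a where "signed S i = (\<Sum>w\<in>walls A S. a w *\<^sub>R signed S w)"
      using wall_coeffs[OF A S i] by metis
    then have "n i = 0" using e by (simp add: signed_def split: if_splits)
    then show False using positive_pos[OF simplicial_good[OF A] i] by simp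
  qed
qed (use walls_subset in blast)

text \<open>A face of the arrangement is given by the pair of \<open>zero\<close> and \<open>neg\<close>. It determines
  the top region containing it, which gives the first reindexing; pairs of a face and a region
  containing it give the second.\<close>

lemma sum_weight:
  assumes A: "simplicial A"
  shows "(\<Sum>T\<in>sep_sets A. weight A T) = (if A = {} then 1 else 0)"
proof -
  note g = simplicial_good[OF A]
  define Cov where "Cov = (\<lambda>x. (zero A x, neg A x)) ` UNIV"
  define h where "h F = (-1) ^ card (basic (fst F)) * int (card (sep_sets (fst F)))" for F :: "'i set \<times> 'i set"
  have finA: "finite A" using positive_finite[OF g] .
  have finR: "finite (sep_sets A)" using finite_sep_sets[OF g] .
  have finP: "finite (Pow (walls A T))" "finite (Pow (lower_walls A T))" for T using finite_walls[OF g] by auto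
  have CovE: "\<exists>x. F = (zero A x, neg A x)" if "F \<in> Cov" for F using that by (auto simp: Cov_def)
  have finC: "finite Cov"
    by (rule finite_subset[of _ "Pow A \<times> Pow A"]) (use finA in \<open>auto simp: Cov_def zero_def neg_def\<close>)
  have finZ: "finite (sep_sets (fst F))" if "F \<in> Cov" for F
    using CovE[OF that] finite_sep_sets[OF positive_subset[OF g zero_subset]] by auto
  have face_Cov: "(flat A K, T - flat A K) \<in> Cov" if TK: "T \<in> sep_sets A" "K \<subseteq> walls A T" for T K
  proof -
    obtain w where "zero A w = flat A K" "neg A w = T - flat A K" using face[OF A TK] .
    then have "(flat A K, T - flat A K) = (zero A w, neg A w)" by simp
    then show ?thesis unfolding Cov_def by blast
  qed
  have "(\<Sum>T\<in>sep_sets A. weight A T) =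
      (\<Sum>(T, K)\<in>Sigma (sep_sets A) (\<lambda>T. Pow (lower_walls A T)). (-1) ^ card K * int (card (sep_sets (flat A K))))"
    unfolding weight_def by (rule sum.Sigma) (use finR finP in auto)
  also have "\<dots> = (\<Sum>F\<in>Cov. h F)"
  proof (rule sum.reindex_bij_witness[where
        j = "\<lambda>(T, K). (flat A K, T - flat A K)" and i = "\<lambda>(Z, N). (N \<union> Z, basic Z)"])
    fix a assume a: "a \<in> Sigma (sep_sets A) (\<lambda>T. Pow (lower_walls A T))"
    obtain T K where [simp]: "a = (T, K)" by force
    have TK: "T \<in> sep_sets A" "K \<subseteq> lower_walls A T" using a by auto
    have b: "basic (flat A K) = K" "flat A K \<subseteq> T" using basic_flat[OF A TK] by auto
    then show "(case case a of (T, K) \<Rightarrow> (flat A K, T - flat A K) of (Z, N) \<Rightarrow> (N \<union> Z, basic Z)) = a"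
      by auto
    show "(case a of (T, K) \<Rightarrow> (flat A K, T - flat A K)) \<in> Cov"
      using face_Cov TK by auto
    show "h (case a of (T, K) \<Rightarrow> (flat A K, T - flat A K)) =
        (case a of (T, K) \<Rightarrow> (-1) ^ card K * int (card (sep_sets (flat A K))))"
      using b by (simp add: h_def)
  next
    fix F assume "F \<in> Cov"
    then obtain x where [simp]: "F = (zero A x, neg A x)" using CovE by blast
    have fb: "flat A (basic (zero A x)) = zero A x" using flat_basic_zero[OF A] .
    have "basic (zero A x) \<subseteq> lower_walls A (neg A x \<union> zero A x)" using top_sep_sets[OF A] by auto
    then show "(case F of (Z, N) \<Rightarrow> (N \<union> Z, basic Z)) \<in> Sigma (sep_sets A) (\<lambda>T. Pow (lower_walls A T))"
      using top_sep_sets(1)[OF A] by auto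
    show "(case case F of (Z, N) \<Rightarrow> (N \<union> Z, basic Z) of (T, K) \<Rightarrow> (flat A K, T - flat A K)) = F"
      using fb neg_zero_disjoint[of A x] by auto
  qed
  also have "\<dots> = (\<Sum>F\<in>Cov. \<Sum>T\<in>sep_sets (fst F). (-1) ^ card (basic (fst F)))"
    by (simp add: h_def mult.commute)
  also have "\<dots> = (\<Sum>(F, T)\<in>Sigma Cov (\<lambda>F. sep_sets (fst F)). (-1) ^ card (basic (fst F)))"
    by (rule sum.Sigma) (use finC finZ in auto)
  \<comment> \<open>A face together with a region of its localization amounts to a region of
    \<open>A\<close> together with the set of its walls through that face.\<close>
  also have "\<dots> = (\<Sum>(T, K)\<in>Sigma (sep_sets A) (\<lambda>T. Pow (walls A T)). (-1) ^ card K)"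
  proof (rule sum.reindex_bij_witness[where
        i = "\<lambda>(T, K). ((flat A K, T - flat A K), T \<inter> flat A K)" and
        j = "\<lambda>a. case a of ((Z, N), T) \<Rightarrow> (N \<union> T, walls A (N \<union> T) \<inter> Z)"])
    fix a assume a: "a \<in> Sigma (sep_sets A) (\<lambda>T. Pow (walls A T))"
    obtain T K where [simp]: "a = (T, K)" by force
    have TK: "T \<in> sep_sets A" "K \<subseteq> walls A T" using a by auto
    have e: "(T - flat A K) \<union> (T \<inter> flat A K) = T" by blast
    show "(case case a of (T, K) \<Rightarrow> ((flat A K, T - flat A K), T \<inter> flat A K) of
        ((Z, N), T) \<Rightarrow> (N \<union> T, walls A (N \<union> T) \<inter> Z)) = a"
      using walls_Int_flat[OF A TK] e by simp
    show "(case a of (T, K) \<Rightarrow> ((flat A K, T - flat A K), T \<inter> flat A K)) \<in> Sigma Cov (\<lambda>F. sep_sets (fst F))"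
      using face_Cov[OF TK] sep_sets_restrict[OF TK(1) flat_subset] by simp
  next
    fix a assume a: "a \<in> Sigma Cov (\<lambda>F. sep_sets (fst F))"
    obtain F S where "a = (F, S)" by (cases a)
    moreover from this a obtain x where "F = (zero A x, neg A x)" using CovE by blast
    ultimately have [simp]: "a = ((zero A x, neg A x), S)" by simp
    have S: "S \<in> sep_sets (zero A x)" using a by simp
    have R: "neg A x \<union> S \<in> sep_sets A" using star_sep_sets[OF g S] .
    have S': "(neg A x \<union> S) \<inter> zero A x = S" "(neg A x \<union> S) - zero A x = neg A x"
      using sep_sets_subset[OF S] neg_zero_disjoint[of A x] by blast+
    have w: "walls (zero A x) S = walls A (neg A x \<union> S) \<inter> zero A x"
      using walls_star[OF g R S'(2)] S'(1) by simp
    let ?K = "walls A (neg A x \<union> S) \<inter> zero A x"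
    have "zero A x \<subseteq> flat A ?K"
    proof
      fix i assume i: "i \<in> zero A x"
      obtain a where "signed S i = (\<Sum>k\<in>?K. a k *\<^sub>R signed S k)"
        using wall_coeffs[OF simplicial_zero[OF A] S i] w by metis
      also have "\<dots> \<in> span (n ` ?K)"
        by (rule span_sum, rule span_scale) (auto simp: signed_def span_base intro: span_neg)
      finally show "i \<in> flat A ?K"
        using i span_neg[of "- n i"] zero_subset by (auto simp: signed_def flat_def split: if_splits)
    qed
    moreover have "flat A ?K \<subseteq> zero A x"
      using flat_orth[of _ A ?K x] flat_subset by (fastforce simp: zero_def)
    ultimately have fl: "flat A ?K = zero A x" by blast
    show "(case case a of ((Z, N), T) \<Rightarrow> (N \<union> T, walls A (N \<union> T) \<inter> Z) of
        (T, K) \<Rightarrow> ((flat A K, T - flat A K), T \<inter> flat A K)) = a"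
      using fl S' by simp
    show "(case a of ((Z, N), T) \<Rightarrow> (N \<union> T, walls A (N \<union> T) \<inter> Z)) \<in> Sigma (sep_sets A) (\<lambda>T. Pow (walls A T))"
      using R by simp
    have gz: "positive (zero A x)" using positive_subset[OF g zero_subset] .
    \<comment> \<open>The sign does not depend on the region around the face: both numbers are the
      codimension of the face.\<close>
    have "card ?K = card (basic (zero A x))"
      using card_walls[OF simplicial_zero[OF A] S] card_walls[OF simplicial_zero[OF A] empty_sep_sets[OF gz]] w by simp
    then show "(case case a of ((Z, N), T) \<Rightarrow> (N \<union> T, walls A (N \<union> T) \<inter> Z) of (T, K) \<Rightarrow> (-1) ^ card K) =
        (case a of (F, T) \<Rightarrow> (-1 :: int) ^ card (basic (fst F)))"
      by simp
  qed
  also have "\<dots> = (\<Sum>T\<in>sep_sets A. \<Sum>K\<in>Pow (walls A T). (-1) ^ card K)"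
    by (rule sum.Sigma[symmetric]) (use finR finP in auto)
  also have "\<dots> = (\<Sum>T\<in>sep_sets A. if A = {} then 1 else 0)"
  proof (rule sum.cong[OF refl])
    fix T assume T: "T \<in> sep_sets A"
    have "Pow (walls A T) = {K. K \<subseteq> walls A T \<and> {} \<subseteq> K}" by auto
    then show "(\<Sum>K\<in>Pow (walls A T). (-1) ^ card K) = (if A = {} then 1 else 0 :: int)"
      using sum_sign_interval[OF finite_walls[OF g, of T], of "{}"] walls_nonempty[OF A T] by auto
  qed
  \<comment> \<open>The empty arrangement has exactly one region.\<close>
  also have "\<dots> = (if A = {} then 1 else 0)"
    by (auto simp: sep_sets_def)
  finally show ?thesis .
qed

lemma sum_weight_below:
  assumes A: "simplicial A" and R: "R \<in> sep_sets A"
  shows "(\<Sum>Q | Q \<in> sep_sets A \<and> cone A R \<subseteq> cone A Q. weight A Q) = (if R = {} then 1 else 0)"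
proof -
  let ?Z = "flat A (lower_walls A R)"
  obtain f where f: "bij_betw f {Q \<in> sep_sets A. cone A R \<subseteq> cone A Q} (sep_sets ?Z)"
    "\<And>Q. Q \<in> sep_sets A \<Longrightarrow> cone A R \<subseteq> cone A Q \<Longrightarrow> lower_walls ?Z (f Q) = lower_walls A Q \<and> lower_walls A Q \<subseteq> ?Z"
    by (rule lower_interval[OF A R]) blast
  have "weight A Q = weight ?Z (f Q)" if Q: "Q \<in> {Q \<in> sep_sets A. cone A R \<subseteq> cone A Q}" for Q
  proof -
    have lower_walls: "lower_walls ?Z (f Q) = lower_walls A Q" "lower_walls A Q \<subseteq> ?Z" using f(2) Q by auto
    \<comment> \<open>\<open>weight\<close> counts regions of further localizations; these lie
      inside \<open>?Z\<close> and are the same there as in \<open>A\<close>.\<close>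
    have "flat ?Z K = flat A K" if "K \<subseteq> lower_walls A Q" for K
    proof -
      have "flat A K \<subseteq> ?Z"
        using flat_idem[of K A "lower_walls A R"] that lower_walls(2) walls_subset by blast
      then show ?thesis by (auto simp: flat_def)
    qed
    then show ?thesis unfolding weight_def lower_walls(1) by (intro sum.cong) auto
  qed
  then have "(\<Sum>Q | Q \<in> sep_sets A \<and> cone A R \<subseteq> cone A Q. weight A Q) =
      (\<Sum>Q | Q \<in> sep_sets A \<and> cone A R \<subseteq> cone A Q. weight ?Z (f Q))"
    by (intro sum.cong) auto
  also have "\<dots> = (\<Sum>T\<in>sep_sets ?Z. weight ?Z T)"
    using sum.reindex_bij_betw[OF f(1)] .
  also have "\<dots> = (if ?Z = {} then 1 else 0)"
  proof (rule sum_weight)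
    obtain p where "zero A p = ?Z" using face_point[OF A R] by metis
    then show "simplicial ?Z" using simplicial_zero[OF A] by metis
  qed
  also have "?Z = {} \<longleftrightarrow> R = {}"
  proof
    assume "?Z = {}"
    then have "lower_walls A R = {}" using flat_base[of "lower_walls A R" A] walls_subset by blast
    then show "R = {}" using all_upper[OF A R] by blast
  next
    assume "R = {}"
    \<comment> \<open>The point \<open>b\<close> lies on no hyperplane, so the flat of the empty set
      is empty.\<close>
    then show "?Z = {}" using flat_basic_zero[OF A, of b] positive_pos[OF simplicial_good[OF A]]
      by (force simp: flat_def)
  qed
  finally show ?thesis .
qed

section \<open>Standard parabolic subsets and the value at the opposite region\<close>

lemma cone_empty: "cone A {} = UNIV"
  by (simp add: cone_def)

text \<open>For walls \<open>K\<close> of the base region, the face cut out by \<open>K\<close> has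
  empty negative set, so lifting a region from the localization adds no separating
  hyperplanes.\<close>

lemma sep_sets_flat:
  assumes A: "simplicial A" and K: "K \<subseteq> basic A"
  shows "sep_sets (flat A K) = {T \<in> sep_sets A. T \<subseteq> flat A K}"
proof -
  note g = simplicial_good[OF A]
  obtain w where w: "zero A w = flat A K" "neg A w = {}"
    using face[OF A empty_sep_sets[OF g] K] by auto
  show ?thesis
  proof (intro equalityI subsetI)
    fix T assume T: "T \<in> sep_sets (flat A K)"
    then show "T \<in> {T \<in> sep_sets A. T \<subseteq> flat A K}"
      using star_sep_sets[OF g, of T w] w sep_sets_subset by auto
  next
    fix T assume "T \<in> {T \<in> sep_sets A. T \<subseteq> flat A K}"
    then show "T \<in> sep_sets (flat A K)"
      using sep_sets_restrict[of T A "flat A K"] flat_subset by (auto simp: Int_absorb2)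
  qed
qed

text \<open>\<open>M\<close> is the support of the nonnegative expansion of the normal of
  \<open>i\<close> in the basic normals; a sum of nonnegative terms at the face point of
  \<open>K\<close> vanishes only termwise.\<close>

lemma flat_support:
  assumes A: "simplicial A" and i: "i \<in> A"
  shows "\<exists>M\<subseteq>basic A. \<forall>K\<subseteq>basic A. i \<in> flat A K \<longleftrightarrow> M \<subseteq> K"
proof -
  note g = simplicial_good[OF A]
  have E: "{} \<in> sep_sets A" using empty_sep_sets[OF g] .
  have fin: "finite (basic A)" using finite_walls[OF g] .
  obtain a where a: "\<And>w. a w \<ge> (0::real)" "signed {} i = (\<Sum>w\<in>basic A. a w *\<^sub>R signed {} w)"
    using wall_coeffs[OF A E i] by blast
  have "i \<in> flat A K \<longleftrightarrow> {w \<in> basic A. a w \<noteq> 0} \<subseteq> K" if K: "K \<subseteq> basic A" for K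
  proof -
    obtain w where w: "\<And>k. k \<in> basic A \<Longrightarrow> signed {} k \<bullet> w = (if k \<in> K then 0 else 1)"
      "zero A w = flat A K"
      using face_coeffs[OF A E K] by metis
    have "n i \<bullet> w = (\<Sum>k\<in>basic A. if k \<in> K then 0 else a k)"
    proof -
      have "n i \<bullet> w = signed {} i \<bullet> w" by (simp add: signed_def)
      also have "\<dots> = (\<Sum>k\<in>basic A. if k \<in> K then 0 else a k)"
        unfolding a(2) inner_sum_left by (rule sum.cong) (auto simp: w(1))
      finally show ?thesis .
    qed
    moreover have "(\<Sum>k\<in>basic A. if k \<in> K then 0 else a k) = 0 \<longleftrightarrow> (\<forall>k\<in>basic A. (if k \<in> K then 0 else a k) = 0)"
      by (rule sum_nonneg_eq_0_iff[OF fin]) (simp add: a)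
    moreover have "i \<in> flat A K \<longleftrightarrow> n i \<bullet> w = 0" using w(2) i by (auto simp: zero_def)
    ultimately show ?thesis by auto
  qed
  then show ?thesis by (intro exI[of _ "{w \<in> basic A. a w \<noteq> 0}"]) auto
qed

lemma weight_full:
  assumes A: "simplicial A"
  shows "weight A A = (\<Sum>K\<in>Pow (basic A). (-1) ^ card K * int (card {T \<in> sep_sets A. T \<subseteq> flat A K}))"
proof -
  have "lower_walls A A = basic A" using walls_opposite[of "{}" A] walls_subset by auto
  then show ?thesis unfolding weight_def using sep_sets_flat[OF A] by (intro sum.cong) auto
qed

text \<open>Let \<open>M\<close> be the union of the supports over the hyperplanes in
  \<open>T\<close>. Then \<open>T\<close> is counted exactly for the \<open>K\<close> containing
  \<open>M\<close>, and the alternating sum over these vanishes unless \<open>M\<close> is all of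
  \<open>basic A\<close>.\<close>

lemma parabolic_sum:
  assumes A: "simplicial A"
  shows "(\<Sum>K\<in>Pow (basic A). (-1) ^ card K * int (card {T \<in> sep_sets A. T \<subseteq> flat A K})) =
    (-1) ^ card (basic A) * int (card {T \<in> sep_sets A. \<forall>K. K \<subseteq> basic A \<and> K \<noteq> basic A \<longrightarrow> \<not> T \<subseteq> flat A K})"
proof -
  note g = simplicial_good[OF A]
  let ?B = "basic A"
  have fin: "finite ?B" "finite (sep_sets A)" using finite_walls[OF g] finite_sep_sets[OF g] by auto
  have sup: "\<exists>M\<subseteq>?B. \<forall>K\<subseteq>?B. T \<subseteq> flat A K \<longleftrightarrow> M \<subseteq> K" if T: "T \<in> sep_sets A" for T
  proof -
    have "\<forall>i\<in>T. \<exists>M. M \<subseteq> ?B \<and> (\<forall>K\<subseteq>?B. i \<in> flat A K \<longleftrightarrow> M \<subseteq> K)"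
      using flat_support[OF A] sep_sets_subset[OF T] by blast
    from bchoice[OF this] obtain M where M: "\<forall>i\<in>T. M i \<subseteq> ?B \<and> (\<forall>K\<subseteq>?B. i \<in> flat A K \<longleftrightarrow> M i \<subseteq> K)"
      by blast
    have "(\<Union>i\<in>T. M i) \<subseteq> ?B" using M by blast
    moreover have "T \<subseteq> flat A K \<longleftrightarrow> (\<Union>i\<in>T. M i) \<subseteq> K" if "K \<subseteq> ?B" for K
    proof -
      have "\<And>i. i \<in> T \<Longrightarrow> i \<in> flat A K \<longleftrightarrow> M i \<subseteq> K" using bspec[OF M] that by simp
      then show ?thesis by auto
    qed
    ultimately show ?thesis by (intro exI[of _ "\<Union>i\<in>T. M i"] conjI allI impI)
  qed
  have "(\<Sum>K\<in>Pow ?B. (-1) ^ card K * int (card {T \<in> sep_sets A. T \<subseteq> flat A K})) =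
      (\<Sum>K\<in>Pow ?B. \<Sum>T\<in>sep_sets A. if T \<subseteq> flat A K then (-1) ^ card K else 0)"
    by (rule sum.cong[OF refl]) (simp add: sum.inter_filter[OF fin(2), symmetric] mult.commute)
  also have "\<dots> = (\<Sum>T\<in>sep_sets A. \<Sum>K\<in>Pow ?B. if T \<subseteq> flat A K then (-1) ^ card K else 0)"
    by (rule sum.swap)
  also have "\<dots> = (\<Sum>T\<in>sep_sets A. if \<forall>K. K \<subseteq> ?B \<and> K \<noteq> ?B \<longrightarrow> \<not> T \<subseteq> flat A K then (-1) ^ card ?B else 0)"
  proof (rule sum.cong[OF refl])
    fix T assume T: "T \<in> sep_sets A"
    obtain M where M': "M \<subseteq> ?B \<and> (\<forall>K\<subseteq>?B. T \<subseteq> flat A K \<longleftrightarrow> M \<subseteq> K)"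
      using sup[OF T] by (rule exE)
    have M: "M \<subseteq> ?B" "\<And>K. K \<subseteq> ?B \<Longrightarrow> T \<subseteq> flat A K \<longleftrightarrow> M \<subseteq> K"
      using M' by simp_all
    have "(\<Sum>K\<in>Pow ?B. if T \<subseteq> flat A K then (-1) ^ card K else 0) =
        (\<Sum>K\<in>{K \<in> Pow ?B. T \<subseteq> flat A K}. (-1) ^ card K :: int)"
      by (rule sum.inter_filter[symmetric]) (use fin in simp)
    also have "{K \<in> Pow ?B. T \<subseteq> flat A K} = {K. K \<subseteq> ?B \<and> M \<subseteq> K}" using M(2) by auto
    also have "(\<Sum>K\<in>{K. K \<subseteq> ?B \<and> M \<subseteq> K}. (-1) ^ card K :: int) = (if M = ?B then (-1) ^ card ?B else 0)"
      using sum_sign_interval[OF fin(1) M(1)] .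
    also have "M = ?B \<longleftrightarrow> (\<forall>K. K \<subseteq> ?B \<and> K \<noteq> ?B \<longrightarrow> \<not> T \<subseteq> flat A K)"
    proof -
      have "T \<subseteq> flat A M" using M(2)[OF M(1)] by simp
      moreover have "\<not> T \<subseteq> flat A K" if "M = ?B" "K \<subseteq> ?B" "K \<noteq> ?B" for K
        using M(2)[OF that(2)] that by auto
      ultimately show ?thesis using M(1) by metis
    qed
    finally show "(\<Sum>K\<in>Pow ?B. if T \<subseteq> flat A K then (-1) ^ card K else 0 :: int) =
        (if \<forall>K. K \<subseteq> ?B \<and> K \<noteq> ?B \<longrightarrow> \<not> T \<subseteq> flat A K then (-1) ^ card ?B else 0)" .
  qed
  also have "\<dots> = (-1) ^ card ?B * int (card {T \<in> sep_sets A. \<forall>K. K \<subseteq> ?B \<and> K \<noteq> ?B \<longrightarrow> \<not> T \<subseteq> flat A K})"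
    by (simp add: sum.inter_filter[OF fin(2), symmetric] mult.commute)
  finally show ?thesis .
qed

end

section \<open>Hyperplane arrangements\<close>

text \<open>Applied with \<open>V\<close> the whole space for regions and with \<open>V\<close> a
  hyperplane for shards.\<close>

lemma connected_component_cell:
  fixes V :: "'a::euclidean_space set"
  assumes V: "convex V" and x: "x \<in> V" "\<And>f. f \<in> F \<Longrightarrow> f \<bullet> x \<noteq> 0"
  shows "connected_component_set {y \<in> V. \<forall>f\<in>F. f \<bullet> y \<noteq> 0} x = {y \<in> V. \<forall>f\<in>F. (f \<bullet> y) * (f \<bullet> x) > 0}"
    (is "connected_component_set ?C x = ?D")
proof
  have "?D = V \<inter> (\<Inter>f\<in>F. {y. ((f \<bullet> x) *\<^sub>R f) \<bullet> y > 0})"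
    by (auto simp: mult.commute)
  then have "convex ?D"
    by (simp only:) (intro convex_Int convex_INT V convex_halfspace_gt)
  then have "connected ?D" by (rule convex_connected)
  moreover have "x \<in> ?D" using x by (auto simp: zero_less_mult_iff linorder_neq_iff)
  moreover have "?D \<subseteq> ?C" by auto
  ultimately show "?D \<subseteq> connected_component_set ?C x"
    by (intro connected_component_maximal)
  show "connected_component_set ?C x \<subseteq> ?D"
  proof
    fix y assume "y \<in> connected_component_set ?C x"
    then obtain K where K: "connected K" "K \<subseteq> ?C" "x \<in> K" "y \<in> K"
      by (auto simp: connected_component_def)
    have "(f \<bullet> y) * (f \<bullet> x) > 0" if f: "f \<in> F" for f
    proof (rule ccontr)
      assume "\<not> (f \<bullet> y) * (f \<bullet> x) > 0"
      then have "f \<bullet> x \<le> 0 \<and> 0 \<le> f \<bullet> y \<or> f \<bullet> y \<le> 0 \<and> 0 \<le> f \<bullet> x"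
        by (auto simp: zero_less_mult_iff)
      then obtain z where "z \<in> K" "f \<bullet> z = 0"
        using connected_ivt_hyperplane[OF K(1)] K(3,4) by metis
      then show False using K(2) f by blast
    qed
    then show "y \<in> ?D" using K by blast
  qed
qed

text \<open>Adding a small multiple of \<open>x\<close> turns the weak inequalities into strict
  ones.\<close>

lemma closure_cell:
  fixes V :: "'a::euclidean_space set"
  assumes V: "subspace V" and x: "x \<in> V" "\<And>f. f \<in> F \<Longrightarrow> f \<bullet> x \<noteq> 0"
  shows "closure {y \<in> V. \<forall>f\<in>F. (f \<bullet> y) * (f \<bullet> x) > 0} = {y \<in> V. \<forall>f\<in>F. (f \<bullet> y) * (f \<bullet> x) \<ge> 0}"
    (is "closure ?D = ?E")
proof
  have "?E = V \<inter> (\<Inter>f\<in>F. {y. ((f \<bullet> x) *\<^sub>R f) \<bullet> y \<ge> 0})"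
    by (auto simp: mult.commute)
  then have "closed ?E"
    by (simp only:) (intro closed_Int closed_INT ballI closed_subspace[OF V] closed_halfspace_ge)
  then show "closure ?D \<subseteq> ?E" by (intro closure_minimal) (auto intro: less_imp_le)
  show "?E \<subseteq> closure ?D"
  proof
    fix y assume y: "y \<in> ?E"
    have "y + e *\<^sub>R x \<in> ?D" if "e > 0" for e
    proof -
      have "(f \<bullet> (y + e *\<^sub>R x)) * (f \<bullet> x) > 0" if f: "f \<in> F" for f
      proof -
        have "(f \<bullet> x) * (f \<bullet> x) > 0" using x(2)[OF f] by (auto simp: zero_less_mult_iff linorder_neq_iff)
        then have "e * ((f \<bullet> x) * (f \<bullet> x)) > 0" using \<open>e > 0\<close> by simp
        moreover have "(f \<bullet> y) * (f \<bullet> x) \<ge> 0" using y f by blast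
        ultimately show ?thesis by (simp add: inner_add_right algebra_simps)
      qed
      then show ?thesis using y x(1) V by (auto intro: subspace_add subspace_scale)
    qed
    then have ev: "\<forall>\<^sub>F e in at_right (0::real). y + e *\<^sub>R x \<in> closure ?D"
      using eventually_at_right_less[of "0::real"] closure_subset
      by (elim eventually_mono) blast
    have "((\<lambda>e. y + e *\<^sub>R x) \<longlongrightarrow> y + 0 *\<^sub>R x) (at_right (0::real))"
      by (intro tendsto_intros)
    then show "y \<in> closure ?D"
      using Lim_in_closed_set[OF closed_closure ev] by simp
  qed
qed

text \<open>The hyperplanes serve as their own indices, so subsets of \<open>A\<close> are at once
  index sets and subarrangements.\<close>

locale based_arrangement = normals n b
  for n :: "'a::euclidean_space set \<Rightarrow> 'a" and b :: 'a +
  fixes A :: "'a set set"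
  assumes finA: "finite A"
    and hyp: "\<And>H. H \<in> A \<Longrightarrow> H = {x. n H \<bullet> x = 0}"
    and pos: "\<And>H. H \<in> A \<Longrightarrow> n H \<bullet> b > 0"
begin

lemma mem_hyp: "H \<in> A \<Longrightarrow> x \<in> H \<longleftrightarrow> n H \<bullet> x = 0"
  using hyp by blast

lemma n_nonzero: "H \<in> A \<Longrightarrow> n H \<noteq> 0"
  using pos by force

lemma positive_A: "positive A"
  unfolding positive_def
proof (intro conjI ballI impI)
  fix i j assume ij: "i \<in> A" "j \<in> A" "i \<noteq> j"
  show "n i \<notin> span {n j}"
  proof
    assume "n i \<in> span {n j}"
    then obtain c where c: "n i = c *\<^sub>R n j" by (auto simp: span_singleton)
    then have "c \<noteq> 0" using n_nonzero ij by auto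
    then have "i = j" using hyp[OF ij(1)] hyp[OF ij(2)] c by simp
    then show False using ij by simp
  qed
qed (use finA pos in auto)

section \<open>Regions and facets in terms of separating sets\<close>

definition region :: "'a set set \<Rightarrow> 'a set set \<Rightarrow> 'a set" where
  "region A' S = {x. \<forall>H\<in>A'. signed S H \<bullet> x \<ge> 0}"

lemma subspace_hyp: "H \<in> A \<Longrightarrow> subspace H"
  using hyp subspace_hyperplane by metis

lemma aff_dim_hyp: "H \<in> A \<Longrightarrow> aff_dim H = int DIM('a) - 1"
proof -
  assume H: "H \<in> A"
  have "aff_dim {x. n H \<bullet> x = 0} = int DIM('a) - 1"
    using aff_dim_hyperplane[OF n_nonzero[OF H]] by simp
  then show ?thesis using hyp[OF H] by simp
qed

lemma affine_hyp: "H \<in> A \<Longrightarrow> affine H"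
  using subspace_hyp subspace_imp_affine by blast

lemma hull_hyp:
  assumes "X \<subseteq> H" "H \<in> A" "aff_dim X = int DIM('a) - 1"
  shows "affine hull X = H"
proof -
  have "affine hull X = affine hull H"
    using aff_dim_eq_full_gen[OF assms(1)] assms aff_dim_hyp by simp
  then show ?thesis using affine_hyp[OF assms(2)] by (simp add: affine_hull_eq)
qed

lemma convex_region: "convex (region A' S)"
proof -
  have "region A' S = (\<Inter>H\<in>A'. {x. signed S H \<bullet> x \<ge> 0})" by (auto simp: region_def)
  then show ?thesis by (auto intro!: convex_INT convex_halfspace_ge)
qed

lemma open_cone: "finite A' \<Longrightarrow> open {y. \<forall>j\<in>A'. signed S j \<bullet> y > 0}"
proof -
  assume "finite A'"
  moreover have "{y. \<forall>j\<in>A'. signed S j \<bullet> y > 0} = (\<Inter>j\<in>A'. {y. signed S j \<bullet> y > 0})" by auto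
  ultimately show ?thesis by (auto intro!: open_INT open_halfspace_gt)
qed

lemma signed_neg: "zero A' x = {} \<or> j \<notin> zero A' x \<Longrightarrow> j \<in> A' \<Longrightarrow>
   (n j \<bullet> y) * (n j \<bullet> x) \<ge> 0 \<longleftrightarrow> signed (neg A' x) j \<bullet> y \<ge> 0"
  by (auto simp: zero_def neg_def signed_def zero_le_mult_iff)

lemma regions_eq:
  assumes "A' \<subseteq> A"
  shows "regions A' = region A' ` sep_sets A'"
proof -
  have U: "UNIV - \<Union>A' = {y \<in> UNIV. \<forall>f\<in>n ` A'. f \<bullet> y \<noteq> 0}"
    using assms mem_hyp by auto
  have cl: "closure (connected_component_set (UNIV - \<Union>A') x) = region A' (neg A' x)"
    if x: "x \<in> UNIV - \<Union>A'" for x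
  proof -
    have nz: "\<And>f. f \<in> n ` A' \<Longrightarrow> f \<bullet> x \<noteq> 0" using x assms mem_hyp by auto
    then have z: "zero A' x = {}" by (auto simp: zero_def)
    have "closure (connected_component_set (UNIV - \<Union>A') x) = {y \<in> UNIV. \<forall>f\<in>n ` A'. (f \<bullet> y) * (f \<bullet> x) \<ge> 0}"
    proof -
      have "connected_component_set {y \<in> UNIV. \<forall>f\<in>n ` A'. f \<bullet> y \<noteq> 0} x =
          {y \<in> UNIV. \<forall>f\<in>n ` A'. (f \<bullet> y) * (f \<bullet> x) > 0}"
        by (rule connected_component_cell) (use nz in auto)
      moreover have "closure {y \<in> UNIV. \<forall>f\<in>n ` A'. (f \<bullet> y) * (f \<bullet> x) > 0} =
          {y \<in> UNIV. \<forall>f\<in>n ` A'. (f \<bullet> y) * (f \<bullet> x) \<ge> 0}"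
        by (rule closure_cell) (use nz in auto)
      ultimately show ?thesis unfolding U by simp
    qed
    also have "\<dots> = region A' (neg A' x)"
      using signed_neg[of A' x] z by (auto simp: region_def)
    finally show ?thesis .
  qed
  have "x \<in> UNIV - \<Union>A' \<longleftrightarrow> zero A' x = {}" for x
    using assms mem_hyp by (auto simp: zero_def)
  then have "regions A' = (\<lambda>x. region A' (neg A' x)) ` {x. zero A' x = {}}"
    unfolding regions_def components_def image_image using cl by (intro image_cong) auto
  also have "\<dots> = region A' ` sep_sets A'"
  proof -
    have "sep_sets A' = neg A' ` {x. zero A' x = {}}" by (rule set_eqI) (unfold sep_sets_iff, blast)
    then show ?thesis by (simp add: image_image)
  qed
  finally show ?thesis .
qed

lemma region_inj: "inj_on (region A') (sep_sets A')"
proof (rule inj_onI)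
  have *: "S \<subseteq> S' \<and> S' \<subseteq> S" if S: "S \<in> sep_sets A'" "S' \<in> sep_sets A'" and eq: "region A' S = region A' S'" for S S'
  proof -
    obtain x where x: "\<forall>i\<in>A'. signed S i \<bullet> x > 0" using S by (auto simp: sep_sets_def)
    then have "x \<in> region A' S'" using eq by (auto simp: region_def less_imp_le)
    then have "i \<in> S \<longleftrightarrow> i \<in> S'" if "i \<in> A'" for i
      using x that by (force simp: region_def signed_def split: if_splits)
    then show ?thesis using sep_sets_subset S by blast
  qed
  fix S S' assume "S \<in> sep_sets A'" "S' \<in> sep_sets A'" "region A' S = region A' S'"
  then show "S = S'" using * by blast
qed

lemma b_in_base: "b \<in> region A {}"
  using pos by (auto simp: region_def signed_def less_imp_le)

lemma base_region:
  assumes "A' \<subseteq> A"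
  shows "(THE R. R \<in> regions A' \<and> region A {} \<subseteq> R) = region A' {}"
proof (rule the_equality)
  show "region A' {} \<in> regions A' \<and> region A {} \<subseteq> region A' {}"
    using regions_eq[OF assms] empty_sep_sets[OF positive_subset[OF positive_A assms]] assms
    by (auto simp: region_def)
  fix R assume R: "R \<in> regions A' \<and> region A {} \<subseteq> R"
  then obtain S where S: "S \<in> sep_sets A'" "R = region A' S" using regions_eq[OF assms] by auto
  have "b \<in> region A' S" using R S b_in_base by blast
  then have "H \<notin> S" if "H \<in> A'" for H
    using that assms pos[of H] by (force simp: region_def signed_def)
  then have "S = {}" using sep_sets_subset[OF S(1)] by blast
  then show "R = region A' {}" using S by simp
qed

text \<open>A relative interior point of \<open>X\<close> is off every other hyperplane
  \<open>j\<close>, since otherwise \<open>X\<close> would lie in \<open>j\<close> and its affine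
  hull would be both \<open>j\<close> and \<open>H\<close>. Used for facets, and for the
  intersection of a region with a shard.\<close>

lemma facet_witness:
  assumes A': "A' \<subseteq> A" and H: "H \<in> A'" and X: "convex X" "X \<subseteq> region A' S \<inter> H"
    "aff_dim X = int DIM('a) - 1" and dim: "X \<noteq> {}"
  shows "\<exists>x\<in>X. n H \<bullet> x = 0 \<and> (\<forall>j\<in>A' - {H}. signed S j \<bullet> x > 0)"
proof -
  obtain x where x: "x \<in> rel_interior X"
    using rel_interior_eq_empty[OF X(1)] dim by blast
  then have xX: "x \<in> X" using rel_interior_subset by blast
  have "signed S j \<bullet> x > 0" if j: "j \<in> A' - {H}" for j
  proof (rule ccontr)
    assume "\<not> signed S j \<bullet> x > 0"
    moreover have "signed S j \<bullet> x \<ge> 0" using xX X(2) j by (auto simp: region_def)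
    ultimately have x0: "signed S j \<bullet> x = 0" by simp
    have "y \<in> j" if y: "y \<in> X" for y
    proof -
      \<comment> \<open>Extend the segment from \<open>y\<close> through \<open>x\<close> slightly
        beyond \<open>x\<close>; nonnegativity of \<open>j\<close> at both ends forces
        \<open>j\<close> to vanish at \<open>y\<close>.\<close>
      obtain e where e: "e > 1" "(1 - e) *\<^sub>R y + e *\<^sub>R x \<in> X"
        using convex_rel_interior_iff[OF X(1) dim] x y by blast
      have "signed S j \<bullet> ((1 - e) *\<^sub>R y + e *\<^sub>R x) \<ge> 0" using e(2) X(2) j by (auto simp: region_def)
      then have "(1 - e) * (signed S j \<bullet> y) \<ge> 0" using x0 by (simp add: inner_add_right)
      then have "signed S j \<bullet> y \<le> 0" using e(1) by (simp add: zero_le_mult_iff)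
      moreover have "signed S j \<bullet> y \<ge> 0" using y X(2) j by (auto simp: region_def)
      ultimately have "signed S j \<bullet> y = 0" by linarith
      then have "n j \<bullet> y = 0" by (simp add: signed_zero_iff)
      then show ?thesis using mem_hyp j A' by blast
    qed
    then have "X \<subseteq> j" by blast
    then have "j = H" using hull_hyp[of X j] hull_hyp[of X H] X j H A' by blast
    then show False using j by blast
  qed
  moreover have "n H \<bullet> x = 0" using xX X(2) mem_hyp H A' by blast
  ultimately show ?thesis using xX by blast
qed

lemma aff_dim_relative_open:
  assumes "H \<in> A" "open U" "x \<in> H" "x \<in> U" "H \<inter> U \<subseteq> X" "X \<subseteq> H"
  shows "aff_dim X = int DIM('a) - 1"
proof -
  have "aff_dim (H \<inter> U) = int DIM('a) - 1"
  proof -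
    have "H \<inter> U \<noteq> {}" using assms(3,4) by blast
    then show ?thesis
      using aff_dim_convex_Int_open[OF subspace_imp_convex[OF subspace_hyp[OF assms(1)]] assms(2)]
        aff_dim_hyp[OF assms(1)] by simp
  qed
  then show ?thesis
    using aff_dim_subset[OF assms(5)] aff_dim_subset[OF assms(6)] aff_dim_hyp[OF assms(1)] by simp
qed

lemma aff_dim_wall:
  assumes A': "A' \<subseteq> A" and H: "H \<in> walls A' S"
  shows "aff_dim (region A' S \<inter> H) = int DIM('a) - 1"
proof -
  obtain x where x: "H \<in> A'" "n H \<bullet> x = 0" "\<forall>j\<in>A' - {H}. signed S j \<bullet> x > 0"
    using H by (auto simp: walls_def)
  have HA: "H \<in> A" using x A' by blast
  show ?thesis
  proof (rule aff_dim_relative_open[OF HA])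
    show "open {y. \<forall>j\<in>A' - {H}. signed S j \<bullet> y > 0}"
      using open_cone finite_subset[OF A' finA] by blast
    show "x \<in> H" using x mem_hyp[OF HA] by simp
    show "x \<in> {y. \<forall>j\<in>A' - {H}. signed S j \<bullet> y > 0}" using x by blast
    show "H \<inter> {y. \<forall>j\<in>A' - {H}. signed S j \<bullet> y > 0} \<subseteq> region A' S \<inter> H"
    proof
      fix y assume y: "y \<in> H \<inter> {y. \<forall>j\<in>A' - {H}. signed S j \<bullet> y > 0}"
      have "signed S j \<bullet> y \<ge> 0" if "j \<in> A'" for j
      proof (cases "j = H")
        case True
        then have "signed S j \<bullet> y = 0" using y mem_hyp[OF HA] by (simp add: signed_zero_iff)
        then show ?thesis by simp
      next
        case False
        then show ?thesis using y that by (auto intro: less_imp_le)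
      qed
      then show "y \<in> region A' S \<inter> H" using y by (auto simp: region_def)
    qed
  qed auto
qed

lemma facet_hyperplanes_eq:
  assumes A': "A' \<subseteq> A" and S: "S \<in> sep_sets A'"
  shows "facet_hyperplanes A' (region A' S) = walls A' S"
proof -
  let ?R = "region A' S"
  have fin: "finite A'" using finite_subset[OF A' finA] .
  have dimR: "aff_dim ?R = int DIM('a)"
  proof -
    obtain t where t: "\<forall>i\<in>A'. signed S i \<bullet> t > 0" using S by (auto simp: sep_sets_def)
    have "{y. \<forall>j\<in>A'. signed S j \<bullet> y > 0} \<subseteq> ?R" by (auto simp: region_def less_imp_le)
    then have "aff_dim {y. \<forall>j\<in>A'. signed S j \<bullet> y > 0} \<le> aff_dim ?R" by (rule aff_dim_subset)
    moreover have "aff_dim {y. \<forall>j\<in>A'. signed S j \<bullet> y > 0} = int DIM('a)"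
      using aff_dim_open[OF open_cone[OF fin]] t by blast
    ultimately show ?thesis using aff_dim_le_DIM[of ?R] by simp
  qed
  have "(?R \<inter> H) facet_of ?R \<longleftrightarrow> H \<in> walls A' S" if H: "H \<in> A'" for H
  proof
    assume f: "(?R \<inter> H) facet_of ?R"
    then have f1: "(?R \<inter> H) face_of ?R" "?R \<inter> H \<noteq> {}" "aff_dim (?R \<inter> H) = int DIM('a) - 1"
      using dimR by (auto simp: facet_of_def)
    have "\<exists>x\<in>?R \<inter> H. n H \<bullet> x = 0 \<and> (\<forall>j\<in>A' - {H}. signed S j \<bullet> x > 0)"
      by (rule facet_witness[OF A' H face_of_imp_convex[OF f1(1)] order_refl f1(3,2)])
    then show "H \<in> walls A' S" using H by (auto simp: walls_def)
  next
    assume w: "H \<in> walls A' S"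
    have HA: "H \<in> A" using H A' by blast
    have eq: "H = {x. signed S H \<bullet> x = 0}" using hyp[OF HA] by (simp add: signed_zero_iff)
    have "(?R \<inter> {x. signed S H \<bullet> x = 0}) face_of ?R"
      by (rule face_of_Int_supporting_hyperplane_ge[OF convex_region])
        (use H in \<open>auto simp: region_def\<close>)
    then have "(?R \<inter> H) face_of ?R" using eq by simp
    moreover have "0 \<in> ?R \<inter> H" using mem_hyp[OF HA] by (auto simp: region_def)
    ultimately show "(?R \<inter> H) facet_of ?R"
      using aff_dim_wall[OF A' w] dimR by (auto simp: facet_of_def)
  qed
  then show ?thesis using walls_subset by (auto simp: facet_hyperplanes_def)
qed

lemma basic_hyperplanes_eq:
  assumes "A' \<subseteq> A"
  shows "basic_hyperplanes A' (region A {}) = basic A'"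
  unfolding basic_hyperplanes_def base_region[OF assms]
  using facet_hyperplanes_eq[OF assms empty_sep_sets[OF positive_subset[OF positive_A assms]]] .

lemma full_subarrangement_eq:
  assumes "K \<subseteq> A"
  shows "full_subarrangement A (\<Inter>K) = flat A K"
proof -
  have "\<Inter>K \<subseteq> H \<longleftrightarrow> n H \<in> span (n ` K)" if H: "H \<in> A" for H
  proof
    assume sub: "\<Inter>K \<subseteq> H"
    show "n H \<in> span (n ` K)"
    proof (rule ccontr)
      assume "n H \<notin> span (n ` K)"
      then obtain u where u: "\<And>w. w \<in> span (n ` K) \<Longrightarrow> w \<bullet> u = 0" "n H \<bullet> u > 0"
        using orth_witness by metis
      have "u \<in> \<Inter>K"
      proof
        fix L assume L: "L \<in> K"
        then have "n L \<bullet> u = 0" using u(1) by (simp add: span_base)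
        then show "u \<in> L" using mem_hyp L assms by blast
      qed
      then show False using sub u(2) mem_hyp[OF H] by auto
    qed
  next
    assume sp: "n H \<in> span (n ` K)"
    show "\<Inter>K \<subseteq> H"
    proof
      fix x assume x: "x \<in> \<Inter>K"
      have "n H \<bullet> x = 0"
        by (rule span_orth[OF sp]) (use x mem_hyp assms in blast)
      then show "x \<in> H" using mem_hyp[OF H] by simp
    qed
  qed
  then show ?thesis by (auto simp: full_subarrangement_def flat_def)
qed

lemma cuts_eq: "cuts A (region A {}) H H' \<longleftrightarrow> cut A H H'"
proof (cases "H \<in> A \<and> H' \<in> A")
  case True
  then have "full_subarrangement A (H \<inter> H') = flat A {H, H'}"
    using full_subarrangement_eq[of "{H, H'}"] by simp
  then show ?thesis using basic_hyperplanes_eq[OF flat_subset] by (auto simp: cuts_def cut_def)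
qed (auto simp: cuts_def cut_def)

lemma separates_iff:
  assumes H: "H \<in> A" and S: "S \<in> sep_sets A"
  shows "separates H (region A S) (region A {}) \<longleftrightarrow> H \<in> S"
proof
  assume HS: "H \<in> S"
  have "normal_vector (n H) H" using n_nonzero[OF H] hyp[OF H] by (simp add: normal_vector_def)
  moreover have "n H \<bullet> x \<le> 0" if "x \<in> region A S" for x
    using that H HS by (force simp: region_def signed_def)
  moreover have "n H \<bullet> x \<ge> 0" if "x \<in> region A {}" for x
    using that H by (force simp: region_def signed_def)
  ultimately show "separates H (region A S) (region A {})" unfolding separates_def by blast
next
  assume "separates H (region A S) (region A {})"
  then obtain m where m: "normal_vector m H" "\<forall>x\<in>region A S. m \<bullet> x \<le> 0" "\<forall>x\<in>region A {}. m \<bullet> x \<ge> 0"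
    by (auto simp: separates_def)
  have mH: "x \<in> H \<longleftrightarrow> m \<bullet> x = 0" for x using m(1) by (auto simp: normal_vector_def)
  show "H \<in> S"
  proof (rule ccontr)
    assume HS: "H \<notin> S"
    obtain x where x: "\<forall>i\<in>A. signed S i \<bullet> x > 0" using S by (auto simp: sep_sets_def)
    have nx: "n H \<bullet> x > 0" using x H HS by (force simp: signed_def)
    have "m \<bullet> x \<le> 0" using m(2) x by (auto simp: region_def less_imp_le)
    moreover have "m \<bullet> x \<noteq> 0" using nx mH mem_hyp[OF H] by force
    ultimately have mx: "m \<bullet> x < 0" by simp
    have "m \<bullet> b \<ge> 0" using m(3) b_in_base by blast
    moreover have "m \<bullet> b \<noteq> 0" using pos[OF H] mH mem_hyp[OF H] by force
    ultimately have mb: "m \<bullet> b > 0" by simp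
    \<comment> \<open>Where the segment from \<open>x\<close> to \<open>b\<close> crosses
      \<open>H\<close> according to \<open>m\<close>, up to scaling; yet \<open>n H\<close> is
      positive at both ends.\<close>
    define z where "z = (m \<bullet> b) *\<^sub>R x + (- (m \<bullet> x)) *\<^sub>R b"
    have "m \<bullet> z = 0" by (simp add: z_def inner_add_right inner_diff_right)
    then have "n H \<bullet> z = 0" using mH mem_hyp[OF H] by blast
    moreover have "(m \<bullet> b) * (n H \<bullet> x) > 0" "(- (m \<bullet> x)) * (n H \<bullet> b) > 0"
      using mb mx nx pos[OF H] by (auto intro: mult_neg_pos)
    ultimately show False unfolding z_def inner_add_right inner_scaleR_right by linarith
  qed
qed

lemma sep_set_eq: "S \<in> sep_sets A \<Longrightarrow> sep_set A (region A {}) (region A S) = S"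
proof -
  assume S: "S \<in> sep_sets A"
  then show ?thesis using separates_iff[OF _ S] sep_sets_subset[OF S] by (auto simp: sep_set_def)
qed

section \<open>Shards and the map to their intersections\<close>

definition shard :: "'a set \<Rightarrow> 'a set set \<Rightarrow> 'a set" where
  "shard H N = {y. n H \<bullet> y = 0 \<and> (\<forall>j. cut A j H \<longrightarrow> signed N j \<bullet> y \<ge> 0)}"

lemma shards_in_eq:
  assumes H: "H \<in> A"
  shows "shards_in A (region A {}) H =
    (\<lambda>x. shard H (neg A x)) ` {x. n H \<bullet> x = 0 \<and> (\<forall>j. cut A j H \<longrightarrow> n j \<bullet> x \<noteq> 0)}"
proof -
  let ?F = "n ` {j. cut A j H}"
  have inA: "j \<in> A" if "cut A j H" for j using that by (simp add: cut_def)
  have U: "H - \<Union>{H'. cuts A (region A {}) H' H} = {y \<in> H. \<forall>f\<in>?F. f \<bullet> y \<noteq> 0}"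
    unfolding cuts_eq using inA mem_hyp by auto
  have cl: "closure (connected_component_set {y \<in> H. \<forall>f\<in>?F. f \<bullet> y \<noteq> 0} x) = shard H (neg A x)"
    if x: "x \<in> H" "\<forall>f\<in>?F. f \<bullet> x \<noteq> 0" for x
  proof -
    have nz: "\<And>f. f \<in> ?F \<Longrightarrow> f \<bullet> x \<noteq> 0" using x by blast
    have "closure (connected_component_set {y \<in> H. \<forall>f\<in>?F. f \<bullet> y \<noteq> 0} x) =
        {y \<in> H. \<forall>f\<in>?F. (f \<bullet> y) * (f \<bullet> x) \<ge> 0}"
    proof -
      have "connected_component_set {y \<in> H. \<forall>f\<in>?F. f \<bullet> y \<noteq> 0} x = {y \<in> H. \<forall>f\<in>?F. (f \<bullet> y) * (f \<bullet> x) > 0}"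
        by (rule connected_component_cell[OF subspace_imp_convex[OF subspace_hyp[OF H]] x(1)]) (rule nz)
      moreover have "closure {y \<in> H. \<forall>f\<in>?F. (f \<bullet> y) * (f \<bullet> x) > 0} = {y \<in> H. \<forall>f\<in>?F. (f \<bullet> y) * (f \<bullet> x) \<ge> 0}"
        by (rule closure_cell[OF subspace_hyp[OF H] x(1)]) (rule nz)
      ultimately show ?thesis by simp
    qed
    also have "\<dots> = shard H (neg A x)"
    proof -
      have "(n j \<bullet> y) * (n j \<bullet> x) \<ge> 0 \<longleftrightarrow> signed (neg A x) j \<bullet> y \<ge> 0" if "cut A j H" for j y
        using signed_neg[of A x j y] nz[of "n j"] inA[OF that] that by (auto simp: zero_def)
      then show ?thesis using mem_hyp[OF H] by (auto simp: shard_def)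
    qed
    finally show ?thesis .
  qed
  show ?thesis
    unfolding shards_in_def U components_def image_image
    by (intro image_cong) (use cl mem_hyp[OF H] in auto)
qed

lemma convex_shard: "convex (shard H N)"
proof -
  have "shard H N = {y. n H \<bullet> y = 0} \<inter> (\<Inter>j\<in>{j. cut A j H}. {y. signed N j \<bullet> y \<ge> 0})"
    by (auto simp: shard_def)
  then show ?thesis by (auto intro!: convex_Int convex_INT convex_hyperplane convex_halfspace_ge)
qed

lemma shard_subset: "H \<in> A \<Longrightarrow> shard H N \<subseteq> H"
  using mem_hyp by (auto simp: shard_def)

lemma aff_dim_shard:
  assumes H: "H \<in> A" and x: "n H \<bullet> x = 0" "\<And>j. cut A j H \<Longrightarrow> n j \<bullet> x \<noteq> 0"
  shows "aff_dim (shard H (neg A x)) = int DIM('a) - 1"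
proof (rule aff_dim_relative_open[OF H])
  have inA: "j \<in> A" if "cut A j H" for j using that by (simp add: cut_def)
  show "open {y. \<forall>j\<in>{j. cut A j H}. signed (neg A x) j \<bullet> y > 0}"
  proof (rule open_cone)
    have "{j. cut A j H} \<subseteq> A" using inA by auto
    then show "finite {j. cut A j H}" using finA finite_subset by blast
  qed
  show "x \<in> H" using x mem_hyp[OF H] by simp
  show "x \<in> {y. \<forall>j\<in>{j. cut A j H}. signed (neg A x) j \<bullet> y > 0}"
    using x(2) inA by (force simp: signed_def neg_def)
  show "H \<inter> {y. \<forall>j\<in>{j. cut A j H}. signed (neg A x) j \<bullet> y > 0} \<subseteq> shard H (neg A x)"
    using mem_hyp[OF H] by (auto simp: shard_def less_imp_le)
qed (rule shard_subset[OF H])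

lemma shard_hyperplane_eq:
  assumes "H \<in> A" "X \<subseteq> H" "aff_dim X = int DIM('a) - 1"
  shows "shard_hyperplane A X = H"
  unfolding shard_hyperplane_def
  by (rule the_equality) (use assms hull_hyp in blast)+

lemma shard_cong: "(\<And>j. cut A j H \<Longrightarrow> j \<in> N \<longleftrightarrow> j \<in> N') \<Longrightarrow> shard H N = shard H N'"
  by (auto simp: shard_def signed_def)

text \<open>A full-dimensional intersection of \<open>region A T\<close> with a shard has a point
  off all other hyperplanes. It shows that \<open>H\<close> is a wall and that the shard has the
  signs of \<open>T\<close> at the cutters. Conversely, each lower wall carries the shard through a
  generic point of its facet.\<close>

lemma lower_shards_eq:
  assumes T: "T \<in> sep_sets A"
  shows "lower_shards A (region A {}) (region A T) = (\<lambda>H. shard H T) ` lower_walls A T"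
proof (intro equalityI subsetI)
  fix X assume "X \<in> lower_shards A (region A {}) (region A T)"
  then obtain H x where H: "H \<in> A" and x: "n H \<bullet> x = 0" "\<And>j. cut A j H \<Longrightarrow> n j \<bullet> x \<noteq> 0"
    and X: "X = shard H (neg A x)" and dim: "aff_dim (region A T \<inter> X) = aff_dim X"
    and sep: "shard_hyperplane A X \<in> sep_set A (region A {}) (region A T)"
    unfolding lower_shards_def shards_def using shards_in_eq by auto
  have dX: "aff_dim X = int DIM('a) - 1" using aff_dim_shard[OF H x] X by simp
  have HT: "H \<in> T"
    using sep shard_hyperplane_eq[OF H _ dX] shard_subset[OF H] X sep_set_eq[OF T] by simp
  have ne: "region A T \<inter> X \<noteq> {}"
  proof -
    have "0 \<in> region A T \<inter> X" unfolding X by (simp add: region_def shard_def)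
    then show ?thesis by blast
  qed
  have "\<exists>y\<in>region A T \<inter> X. n H \<bullet> y = 0 \<and> (\<forall>j\<in>A - {H}. signed T j \<bullet> y > 0)"
    by (rule facet_witness[OF order_refl H _ _ _ ne])
      (use X shard_subset[OF H] dim dX convex_region convex_shard in \<open>auto intro: convex_Int\<close>)
  then obtain y where y: "y \<in> X" "n H \<bullet> y = 0" "\<forall>j\<in>A - {H}. signed T j \<bullet> y > 0" by blast
  then have w: "H \<in> walls A T" using H by (auto simp: walls_def)
  have "shard H (neg A x) = shard H T"
  proof (rule shard_cong)
    fix j assume j: "cut A j H"
    then have "signed (neg A x) j \<bullet> y \<ge> 0" using y(1) X by (auto simp: shard_def)
    moreover have "signed T j \<bullet> y > 0" using y(3) j by (auto simp: cut_def)
    ultimately show "j \<in> neg A x \<longleftrightarrow> j \<in> T" by (auto simp: signed_def split: if_splits)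
  qed
  then show "X \<in> (\<lambda>H. shard H T) ` lower_walls A T" using w HT X by blast
next
  fix X assume "X \<in> (\<lambda>H. shard H T) ` lower_walls A T"
  then obtain H where H: "H \<in> walls A T" "H \<in> T" and X: "X = shard H T" by blast
  have HA: "H \<in> A" using H walls_subset by blast
  obtain x where x: "zero A x = {H}" "neg A x = T - {H}"
    using H walls_iff[OF sep_sets_subset[OF T]] by blast
  have xH: "n H \<bullet> x = 0" using x(1) by (auto simp: zero_def)
  have xj: "n j \<bullet> x \<noteq> 0" if "cut A j H" for j using x(1) that by (auto simp: zero_def cut_def)
  have eq: "shard H (neg A x) = X"
    unfolding X by (rule shard_cong) (use x(2) in \<open>auto simp: cut_def\<close>)
  have dX: "aff_dim X = int DIM('a) - 1" using aff_dim_shard[OF HA xH xj] eq by simp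
  have XH: "X \<subseteq> H" using shard_subset[OF HA] X by simp
  have "X \<in> shards A (region A {})"
    unfolding shards_def using shards_in_eq[OF HA] HA xH xj eq by blast
  moreover have "region A T \<inter> X = region A T \<inter> H"
  proof -
    have "signed T j \<bullet> y \<ge> 0" if "y \<in> region A T" "cut A j H" for y j
      using that by (auto simp: region_def cut_def)
    then show ?thesis using mem_hyp[OF HA] unfolding X shard_def by blast
  qed
  then have "aff_dim (region A T \<inter> X) = aff_dim X"
    using aff_dim_wall[OF order_refl H(1)] dX by simp
  ultimately show "X \<in> lower_shards A (region A {}) (region A T)"
    using shard_hyperplane_eq[OF HA XH dX] sep_set_eq[OF T] H by (auto simp: lower_shards_def)
qed

lemma shard_meet_eq: "T \<in> sep_sets A \<Longrightarrow> shard_meet A (region A {}) (region A T) = cone A T"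
  unfolding shard_meet_def using lower_shards_eq by (auto simp: shard_def cone_def)

lemma shard_order_iff:
  assumes "Q \<in> sep_sets A" "R \<in> sep_sets A"
  shows "(region A Q, region A R) \<in> shard_order A (region A {}) \<longleftrightarrow> cone A R \<subseteq> cone A Q"
  using assms regions_eq[of A] shard_meet_eq by (auto simp: shard_order_def)

lemma simplicial_A:
  assumes "simplicial_arrangement A"
  shows "simplicial A"
  unfolding simplicial_def
proof (intro conjI ballI)
  fix S assume S: "S \<in> sep_sets A"
  then have "region A S \<in> regions A" using regions_eq[of A] by blast
  moreover have "\<forall>H\<in>facet_hyperplanes A (region A S). normal_vector (n H) H"
    using n_nonzero hyp by (auto simp: facet_hyperplanes_def normal_vector_def)
  ultimately have "independent (n ` facet_hyperplanes A (region A S))"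
    using assms by (auto simp: simplicial_arrangement_def)
  then show "independent (n ` walls A S)" using facet_hyperplanes_eq[OF order_refl S] by simp
qed (rule positive_A)

lemma uminus_base: "uminus ` region A {} = region A A"
proof -
  have "x \<in> region A A \<longleftrightarrow> - x \<in> region A {}" for x by (auto simp: region_def signed_def)
  then show ?thesis by (metis (no_types, lifting) equalityI image_eqI image_subsetI minus_minus subsetI)
qed

text \<open>The intersection of \<open>A\<close> is the orthogonal complement of the span of the
  normals, of which the basic normals are a basis.\<close>

lemma arr_rank_eq:
  assumes "simplicial A"
  shows "arr_rank A = card (basic A)"
proof -
  have "\<Inter>A = {y \<in> UNIV. \<forall>x\<in>span (n ` A). orthogonal x y}"
  proof (intro equalityI subsetI)
    fix y assume y: "y \<in> \<Inter>A"
    have "v \<bullet> y = 0" if "v \<in> span (n ` A)" for v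
      by (rule span_orth[OF that]) (use y mem_hyp in blast)
    then show "y \<in> {y \<in> UNIV. \<forall>x\<in>span (n ` A). orthogonal x y}" by (simp add: orthogonal_def)
  next
    fix y assume "y \<in> {y \<in> UNIV. \<forall>x\<in>span (n ` A). orthogonal x y}"
    then show "y \<in> \<Inter>A" using mem_hyp by (auto simp: orthogonal_def span_base)
  qed
  then have "dim (\<Inter>A) + dim (span (n ` A)) = DIM('a)"
    using dim_subspace_orthogonal_to_vectors[OF subspace_span subspace_UNIV, of "n ` A"] by simp
  then show ?thesis
    using card_walls[OF assms empty_sep_sets[OF positive_A]] by (simp add: arr_rank_def)
qed

lemma parabolic_subset_eq:
  assumes "K \<subseteq> basic A"
  shows "parabolic_subset A (region A {}) K = region A ` {T \<in> sep_sets A. T \<subseteq> flat A K}"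
proof -
  have "K \<subseteq> A" using assms walls_subset by blast
  then show ?thesis
    using full_subarrangement_eq regions_eq[of A] sep_set_eq by (auto simp: parabolic_subset_def)
qed

lemma card_region_image: "X \<subseteq> sep_sets A \<Longrightarrow> card (region A ` X) = card X"
  by (rule card_image) (rule inj_on_subset[OF region_inj])

lemma moebius_regions:
  assumes "simplicial_arrangement A"
  shows "moebius (regions A) (shard_order A (region A {})) (region A {}) (region A A) = weight A A"
proof -
  let ?r = "shard_order A (region A {})"
  let ?inv = "the_inv_into (sep_sets A) (region A)"
  have s: "simplicial A" using simplicial_A[OF assms] .
  have reg: "regions A = region A ` sep_sets A" using regions_eq[of A] by simp
  have inv: "?inv (region A T) = T" if "T \<in> sep_sets A" for T
    using the_inv_into_f_f[OF region_inj that] .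
  have E: "{} \<in> sep_sets A" "A \<in> sep_sets A" using empty_sep_sets[OF positive_A] full_sep_sets[OF positive_A] by auto
  \<comment> \<open>The inverse of \<open>region A\<close> carries \<open>weight\<close>, a function
    of separating sets, over to regions.\<close>
  have "moebius (regions A) ?r (region A {}) (region A A) = weight A (?inv (region A A))"
  proof (rule moebius_eqI)
    show "finite (regions A)" using reg finite_sep_sets[OF positive_A] by simp
    show "partial_order_on (regions A) ?r"
      unfolding partial_order_on_def preorder_on_def
    proof (intro conjI)
      show "?r \<subseteq> regions A \<times> regions A" by (auto simp: shard_order_def)
      show "refl_on (regions A) ?r" by (auto simp: shard_order_def refl_on_def)
      show "trans ?r" by (rule transI) (auto simp: shard_order_def)
      show "antisym ?r"
      proof (rule antisymI)
        fix X Y assume XY: "(X, Y) \<in> ?r" "(Y, X) \<in> ?r"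
        then obtain Q R where QR: "Q \<in> sep_sets A" "R \<in> sep_sets A" "X = region A Q" "Y = region A R"
          using reg by (auto simp: shard_order_def)
        then have "cone A Q = cone A R" using XY shard_order_iff by blast
        then show "X = Y" using cone_antisym[OF s QR(1,2)] QR by simp
      qed
    qed
    show "region A {} \<in> regions A" "region A A \<in> regions A" using reg E by blast+
    show "(region A {}, Y) \<in> ?r" if "Y \<in> regions A" for Y
      using that reg shard_order_iff[OF E(1)] cone_empty by auto
    show "(\<Sum>Z | Z \<in> regions A \<and> (Z, Y) \<in> ?r. weight A (?inv Z)) = (if Y = region A {} then 1 else 0)"
      if Y: "Y \<in> regions A" for Y
    proof -
      obtain R where R: "R \<in> sep_sets A" "Y = region A R" using Y reg by blast
      let ?D = "{Q. Q \<in> sep_sets A \<and> cone A R \<subseteq> cone A Q}"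
      have "{Z. Z \<in> regions A \<and> (Z, Y) \<in> ?r} = region A ` ?D"
        using reg shard_order_iff R by auto
      moreover have "inj_on (region A) ?D" by (rule inj_on_subset[OF region_inj]) auto
      ultimately have "(\<Sum>Z | Z \<in> regions A \<and> (Z, Y) \<in> ?r. weight A (?inv Z)) = (\<Sum>Q\<in>?D. weight A (?inv (region A Q)))"
        by (simp add: sum.reindex)
      also have "\<dots> = (\<Sum>Q\<in>?D. weight A Q)" by (rule sum.cong) (auto simp: inv)
      also have "\<dots> = (if R = {} then 1 else 0)" using sum_weight_below[OF s R(1)] .
      also have "R = {} \<longleftrightarrow> Y = region A {}"
        using inj_onD[OF region_inj _ R(1) E(1)] R by auto
      finally show ?thesis .
    qed
  qed
  then show ?thesis using inv[OF E(2)] by simp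
qed

end

lemma exists_normal:
  assumes "linear_hyperplane (H :: 'a::euclidean_space set)" "b \<notin> H"
  shows "\<exists>a. H = {x. a \<bullet> x = 0} \<and> a \<bullet> b > 0"
proof -
  have H: "subspace H" "dim H + 1 = DIM('a)" using assms by (auto simp: linear_hyperplane_def)
  then obtain a where a: "a \<noteq> 0" "span H \<subseteq> {x. a \<bullet> x = 0}"
    using lowdim_subset_hyperplane[of H] by auto
  have "H = {x. a \<bullet> x = 0}"
    by (rule subspace_dim_equal)
      (use H a dim_hyperplane[OF a(1)] span_superset subspace_hyperplane in auto)
  moreover from this have "a \<bullet> b \<noteq> 0" using assms(2) by auto
  ultimately show ?thesis
    by (intro exI[of _ "if a \<bullet> b > 0 then a else - a"]) auto
qed

lemma exists_based_arrangement:
  assumes "arrangement A" "B \<in> regions A"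
  obtains n b where "based_arrangement n b A" "B = based_arrangement.region n A {}"
proof -
  obtain b where b: "b \<in> UNIV - \<Union>A" "B = closure (connected_component_set (UNIV - \<Union>A) b)"
    using assms(2) by (auto simp: regions_def components_def)
  have "\<forall>H\<in>A. \<exists>a. H = {x. a \<bullet> x = 0} \<and> a \<bullet> b > 0"
  proof
    fix H assume "H \<in> A"
    then show "\<exists>a. H = {x. a \<bullet> x = 0} \<and> a \<bullet> b > 0"
      by (intro exists_normal) (use assms(1) b(1) in \<open>auto simp: arrangement_def\<close>)
  qed
  from bchoice[OF this] obtain n where n: "\<forall>H\<in>A. H = {x. n H \<bullet> x = 0} \<and> n H \<bullet> b > 0" by blast
  interpret based_arrangement n b A
    by unfold_locales (use n assms(1) in \<open>auto simp: arrangement_def\<close>)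
  have nz: "\<And>f. f \<in> n ` A \<Longrightarrow> f \<bullet> b \<noteq> 0" using pos by force
  have U: "UNIV - \<Union>A = {y \<in> UNIV. \<forall>f\<in>n ` A. f \<bullet> y \<noteq> 0}" using mem_hyp by auto
  have "B = {y \<in> UNIV. \<forall>f\<in>n ` A. (f \<bullet> y) * (f \<bullet> b) \<ge> 0}"
  proof -
    have "connected_component_set {y \<in> UNIV. \<forall>f\<in>n ` A. f \<bullet> y \<noteq> 0} b =
        {y \<in> UNIV. \<forall>f\<in>n ` A. (f \<bullet> y) * (f \<bullet> b) > 0}"
      by (rule connected_component_cell) (use nz in auto)
    moreover have "closure {y \<in> UNIV. \<forall>f\<in>n ` A. (f \<bullet> y) * (f \<bullet> b) > 0} =
        {y \<in> UNIV. \<forall>f\<in>n ` A. (f \<bullet> y) * (f \<bullet> b) \<ge> 0}"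
      by (rule closure_cell) (use nz in auto)
    ultimately show ?thesis unfolding b(2) U by simp
  qed
  also have "\<dots> = region A {}"
    using pos by (auto simp: region_def signed_def zero_le_mult_iff not_less dest: less_le_not_le[THEN iffD1])
  finally show ?thesis using that based_arrangement_axioms by blast
qed

theorem theorem5p9:
  fixes \<A> :: "'a::euclidean_space set set" and B :: "'a set"
  assumes "simplicial_arrangement \<A>"
    and "B \<in> regions \<A>"
  shows "moebius (regions \<A>) (shard_order \<A> B) B (uminus ` B) =
           (-1) ^ arr_rank \<A> *
           int (card {R \<in> regions \<A>.
             \<forall>\<K>. \<K> \<subseteq> basic_hyperplanes \<A> B \<and> \<K> \<noteq> basic_hyperplanes \<A> B \<longrightarrow>
               R \<notin> parabolic_subset \<A> B \<K>}) \<and>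
         moebius (regions \<A>) (shard_order \<A> B) B (uminus ` B) =
           (\<Sum>\<K>\<in>Pow (basic_hyperplanes \<A> B).
              (-1) ^ card \<K> * int (card (parabolic_subset \<A> B \<K>)))"
proof -
  have "arrangement \<A>" using assms(1) by (simp add: simplicial_arrangement_def)
  then obtain n b where nb: "based_arrangement n b \<A>" "B = based_arrangement.region n \<A> {}"
    using exists_based_arrangement assms(2) by blast
  interpret based_arrangement n b \<A> by (rule nb(1))
  have s: "simplicial \<A>" using simplicial_A[OF assms(1)] .
  have B: "B = region \<A> {}" using nb(2) .
  have bas: "basic_hyperplanes \<A> B = basic \<A>" using basic_hyperplanes_eq[of \<A>] B by simp
  have par: "parabolic_subset \<A> B K = region \<A> ` {T \<in> sep_sets \<A>. T \<subseteq> flat \<A> K}" if "K \<subseteq> basic \<A>" for K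
    using parabolic_subset_eq[OF that] B by simp
  have mu: "moebius (regions \<A>) (shard_order \<A> B) B (uminus ` B) = weight \<A> \<A>"
    using moebius_regions[OF assms(1)] uminus_base B by simp
  have "weight \<A> \<A> = (\<Sum>K\<in>Pow (basic \<A>). (-1) ^ card K * int (card {T \<in> sep_sets \<A>. T \<subseteq> flat \<A> K}))"
    using weight_full[OF s] .
  also have "\<dots> = (\<Sum>K\<in>Pow (basic \<A>). (-1) ^ card K * int (card (parabolic_subset \<A> B K)))"
    by (rule sum.cong) (auto simp: par card_region_image)
  finally have sum2: "weight \<A> \<A> = (\<Sum>K\<in>Pow (basic \<A>). (-1) ^ card K * int (card (parabolic_subset \<A> B K)))" .
  have "{R \<in> regions \<A>. \<forall>K. K \<subseteq> basic \<A> \<and> K \<noteq> basic \<A> \<longrightarrow> R \<notin> parabolic_subset \<A> B K} =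
      region \<A> ` {T \<in> sep_sets \<A>. \<forall>K. K \<subseteq> basic \<A> \<and> K \<noteq> basic \<A> \<longrightarrow> \<not> T \<subseteq> flat \<A> K}" (is "?X = region \<A> ` ?Y")
  proof -
    have "region \<A> T \<in> parabolic_subset \<A> B K \<longleftrightarrow> T \<subseteq> flat \<A> K"
      if "T \<in> sep_sets \<A>" "K \<subseteq> basic \<A>" for T K
      unfolding par[OF that(2)] using inj_on_image_mem_iff[OF region_inj that(1)] that(1) by simp
    then have "region \<A> T \<in> ?X \<longleftrightarrow> T \<in> ?Y" if "T \<in> sep_sets \<A>" for T
      using that regions_eq[of \<A>] by auto
    then show ?thesis using regions_eq[of \<A>] by auto
  qed
  then have "card ?X = card ?Y" using card_region_image[of ?Y] by auto
  then have "weight \<A> \<A> = (-1) ^ arr_rank \<A> * int (card ?X)"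
    using parabolic_sum[OF s] weight_full[OF s] arr_rank_eq[OF s] by simp
  then show ?thesis using mu sum2 bas by simp
qed

end
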